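(* Let $\mathcal{T}\subset M_2(\mathbb{C})$ be the operator system of $2\times 2$ complex Toeplitz matrices, i.e. all matrices $\begin{pmatrix} t_0 & t_1\\ t_{-1} & t_0\end{pmatrix}$ with $t_{-1},t_0,t_1\in\mathbb{C}$. Then the $C^*$-envelope of $\mathcal{T}$ is $M_2(\mathbb{C})$ (with the inclusion map), and: (1) the matrix signature induces bijections $\pi_0(\mathcal{T}_h^\times)\cong\{-2,0,2\}$ and $\pi_0(M_2(\mathbb{C})_h^\times)\cong\{-2,0,2\}$; (2) $\pi_0(\mathcal{T}^\times)$ and $\pi_0(M_2(\mathbb{C})^\times)$ each consist of a single element, i.e. $\mathcal{T}^\times$ and $M_2(\mathbb{C})^\times$ are path connected.
   Context: A (concrete) operator system is a $*$-closed, norm-closed linear space of bounded operators on a Hilbert space containing the unit. Its $C^*$-envelope $C^*_{\mathrm{env}}(E)$, with a unital complete order embedding $\imath_E:E\to C^*_{\mathrm{env}}(E)$ whose image generates it, is the smallest $C^*$-algebra generated by a unital completely order isomorphic copy of $E$: for any unital complete order embedding $j:E\to B$ into a $C^*$-algebra $B$ generated by $j(E)$, there is a surjective $*$-homomorphism $\rho: B\to C^*_{\mathrm{env}}(E)$ with $\rho\circ j=\imath_E$. For an operator system $E$, $E^\times$ denotes the set of $x\in E$ such that $\imath_E(x)$ is invertible in $C^*_{\mathrm{env}}(E)$, and $E_h^\times$ denotes the set of self-adjoint elements of $E^\times$; both carry the norm topology. For a unital $C^*$-algebra $A$, its $C^*$-envelope is $A$ itself, so $A^\times$ is the set of invertible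 elements and $A_h^\times$ the set of invertible self-adjoint elements. $\pi_0$ denotes the set of path components. The signature of an invertible hermitian matrix is the number of positive eigenvalues minus the number of negative eigenvalues, counted with multiplicity. *)

theory Defs
  imports
    "HOL-Analysis.Analysis"
    "HOL-Algebra.Module"
    "HOL-Computational_Algebra.Polynomial"
begin

section \<open>Unital \<open>C\<^sup>*\<close>-algebras\<close>

record 'a cstar = "(complex, 'a) module" +
  star :: "'a \<Rightarrow> 'a"
  cnorm :: "'a \<Rightarrow> real"

text \<open>The cut-off outside the carrier makes this satisfy the locale \<^locale>\<open>Metric_space\<close>, which
  requires symmetry and nonnegativity on the whole type.\<close>

definition cdist :: "('a, 'm) cstar_scheme \<Rightarrow> 'a \<Rightarrow> 'a \<Rightarrow> real" where
  "cdist A x y =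
     (if x \<in> carrier A \<and> y \<in> carrier A then cnorm A (x \<ominus>\<^bsub>A\<^esub> y) else 0)"

definition norm_topology :: "('a, 'm) cstar_scheme \<Rightarrow> 'a topology" where
  "norm_topology A = Metric_space.mtopology (carrier A) (cdist A)"

locale unital_cstar_algebra = ring A for A :: "('a, 'm) cstar_scheme" (structure) +
  assumes smult_closed: "x \<in> carrier A \<Longrightarrow> c \<odot> x \<in> carrier A"
    and smult_l_distr: "x \<in> carrier A \<Longrightarrow> (c + d) \<odot> x = c \<odot> x \<oplus> d \<odot> x"
    and smult_r_distr:
      "\<lbrakk>x \<in> carrier A; y \<in> carrier A\<rbrakk> \<Longrightarrow> c \<odot> (x \<oplus> y) = c \<odot> x \<oplus> c \<odot> y"
    and smult_assoc: "x \<in> carrier A \<Longrightarrow> (c * d) \<odot> x = c \<odot> (d \<odot> x)"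
    and smult_one: "x \<in> carrier A \<Longrightarrow> 1 \<odot> x = x"
    and smult_mult_left:
      "\<lbrakk>x \<in> carrier A; y \<in> carrier A\<rbrakk> \<Longrightarrow> (c \<odot> x) \<otimes> y = c \<odot> (x \<otimes> y)"
    and smult_mult_right:
      "\<lbrakk>x \<in> carrier A; y \<in> carrier A\<rbrakk> \<Longrightarrow> x \<otimes> (c \<odot> y) = c \<odot> (x \<otimes> y)"
    and star_closed: "x \<in> carrier A \<Longrightarrow> star A x \<in> carrier A"
    and star_star: "x \<in> carrier A \<Longrightarrow> star A (star A x) = x"
    and star_add:
      "\<lbrakk>x \<in> carrier A; y \<in> carrier A\<rbrakk> \<Longrightarrow> star A (x \<oplus> y) = star A x \<oplus> star A y"
    and star_smult: "x \<in> carrier A \<Longrightarrow> star A (c \<odot> x) = cnj c \<odot> star A x"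
    and star_mult:
      "\<lbrakk>x \<in> carrier A; y \<in> carrier A\<rbrakk> \<Longrightarrow> star A (x \<otimes> y) = star A y \<otimes> star A x"
    and cnorm_nonneg: "x \<in> carrier A \<Longrightarrow> 0 \<le> cnorm A x"
    and cnorm_eq_zero: "x \<in> carrier A \<Longrightarrow> cnorm A x = 0 \<longleftrightarrow> x = \<zero>"
    and cnorm_triangle:
      "\<lbrakk>x \<in> carrier A; y \<in> carrier A\<rbrakk> \<Longrightarrow> cnorm A (x \<oplus> y) \<le> cnorm A x + cnorm A y"
    and cnorm_smult: "x \<in> carrier A \<Longrightarrow> cnorm A (c \<odot> x) = cmod c * cnorm A x"
    and cnorm_mult:
      "\<lbrakk>x \<in> carrier A; y \<in> carrier A\<rbrakk> \<Longrightarrow> cnorm A (x \<otimes> y) \<le> cnorm A x * cnorm A y"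
    and cstar_identity: "x \<in> carrier A \<Longrightarrow> cnorm A (star A x \<otimes> x) = (cnorm A x)\<^sup>2"
    and complete: "Metric_space.mcomplete (carrier A) (cdist A)"

definition star_hom ::
    "('a, 'm) cstar_scheme \<Rightarrow> ('b, 'k) cstar_scheme \<Rightarrow> ('a \<Rightarrow> 'b) \<Rightarrow> bool" where
  "star_hom A B f \<longleftrightarrow>
     f \<in> carrier A \<rightarrow> carrier B \<and>
     (\<forall>x\<in>carrier A. \<forall>y\<in>carrier A. f (x \<oplus>\<^bsub>A\<^esub> y) = f x \<oplus>\<^bsub>B\<^esub> f y) \<and>
     (\<forall>c. \<forall>x\<in>carrier A. f (c \<odot>\<^bsub>A\<^esub> x) = c \<odot>\<^bsub>B\<^esub> f x) \<and>
     (\<forall>x\<in>carrier A. \<forall>y\<in>carrier A. f (x \<otimes>\<^bsub>A\<^esub> y) = f x \<otimes>\<^bsub>B\<^esub> f y) \<and>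
     (\<forall>x\<in>carrier A. f (star A x) = star B (f x))"

definition closed_star_subspace :: "('a, 'm) cstar_scheme \<Rightarrow> 'a set \<Rightarrow> bool" where
  "closed_star_subspace A D \<longleftrightarrow>
     closedin (norm_topology A) D \<and>
     \<zero>\<^bsub>A\<^esub> \<in> D \<and>
     (\<forall>x\<in>D. \<forall>y\<in>D. x \<oplus>\<^bsub>A\<^esub> y \<in> D) \<and>
     (\<forall>c. \<forall>x\<in>D. c \<odot>\<^bsub>A\<^esub> x \<in> D) \<and>
     (\<forall>x\<in>D. star A x \<in> D)"

definition cstar_subalgebra :: "('a, 'm) cstar_scheme \<Rightarrow> 'a set \<Rightarrow> bool" where
  "cstar_subalgebra A D \<longleftrightarrow>
     closed_star_subspace A D \<and> (\<forall>x\<in>D. \<forall>y\<in>D. x \<otimes>\<^bsub>A\<^esub> y \<in> D)"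

definition cstar_generated :: "('a, 'm) cstar_scheme \<Rightarrow> 'a set \<Rightarrow> 'a set" where
  "cstar_generated A S = \<Inter>{D. cstar_subalgebra A D \<and> S \<subseteq> D}"


section \<open>Operator systems and their \<open>C\<^sup>*\<close>-envelopes\<close>

text \<open>Operator systems are taken inside a unital \<open>C\<^sup>*\<close>-algebra \<open>A\<close>, which may be thought of as
  acting on a Hilbert space by the Gelfand-Naimark theorem.\<close>

definition operator_system :: "('a, 'm) cstar_scheme \<Rightarrow> 'a set \<Rightarrow> bool" where
  "operator_system A E \<longleftrightarrow> closed_star_subspace A E \<and> \<one>\<^bsub>A\<^esub> \<in> E"

text \<open>Positivity in the \<open>C\<^sup>*\<close>-algebra \<open>M\<^sub>n(A)\<close>: the matrix \<open>X\<close>, of which only the entries with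
  indices below \<open>n\<close> matter, has the form \<open>Y\<^sup>* Y\<close>. The matrix order of an operator system
  \<open>E \<subseteq> A\<close> is the restriction of this one.\<close>

definition mat_positive :: "('a, 'm) cstar_scheme \<Rightarrow> nat \<Rightarrow> (nat \<Rightarrow> nat \<Rightarrow> 'a) \<Rightarrow> bool" where
  "mat_positive A n X \<longleftrightarrow>
     (\<exists>Y. (\<forall>i<n. \<forall>j<n. Y i j \<in> carrier A) \<and>
          (\<forall>i<n. \<forall>j<n. X i j = (\<Oplus>\<^bsub>A\<^esub>k\<in>{..<n}. star A (Y k i) \<otimes>\<^bsub>A\<^esub> Y k j)))"

definition complete_order_embedding ::
    "('a, 'm) cstar_scheme \<Rightarrow> 'a set \<Rightarrow> ('b, 'k) cstar_scheme \<Rightarrow> ('a \<Rightarrow> 'b) \<Rightarrow> bool" where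
  "complete_order_embedding A E B f \<longleftrightarrow>
     f \<in> E \<rightarrow> carrier B \<and> inj_on f E \<and>
     (\<forall>x\<in>E. \<forall>y\<in>E. f (x \<oplus>\<^bsub>A\<^esub> y) = f x \<oplus>\<^bsub>B\<^esub> f y) \<and>
     (\<forall>c. \<forall>x\<in>E. f (c \<odot>\<^bsub>A\<^esub> x) = c \<odot>\<^bsub>B\<^esub> f x) \<and>
     (\<forall>n X. (\<forall>i<n. \<forall>j<n. X i j \<in> E) \<longrightarrow>
        (mat_positive A n X \<longleftrightarrow> mat_positive B n (\<lambda>i j. f (X i j))))"

definition generating_embedding ::
    "('a, 'm) cstar_scheme \<Rightarrow> 'a set \<Rightarrow> ('b, 'k) cstar_scheme \<Rightarrow> ('a \<Rightarrow> 'b) \<Rightarrow> bool" where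
  "generating_embedding A E B f \<longleftrightarrow>
     unital_cstar_algebra B \<and> complete_order_embedding A E B f \<and> f \<one>\<^bsub>A\<^esub> = \<one>\<^bsub>B\<^esub> \<and>
     cstar_generated B (f ` E) = carrier B"

text \<open>\<open>C\<close>, with the map \<open>\<iota>\<close>, is a \<open>C\<^sup>*\<close>-envelope of the operator system \<open>E \<subseteq> A\<close>. HOL cannot
  quantify over types inside a definition, so the algebras \<open>B\<close> in the universal property have
  their carriers in the type passed as first argument; a theorem asserting this for
  \<open>TYPE('b)\<close> with \<open>'b\<close> a type variable covers all of them.\<close>

definition is_cstar_envelope ::
    "'b itself \<Rightarrow> 'a cstar \<Rightarrow> 'a set \<Rightarrow> 'c cstar \<Rightarrow> ('a \<Rightarrow> 'c) \<Rightarrow> bool" where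
  "is_cstar_envelope (_ :: 'b itself) A E C \<iota> \<longleftrightarrow>
     unital_cstar_algebra A \<and> operator_system A E \<and> generating_embedding A E C \<iota> \<and>
     (\<forall>(B :: 'b cstar) j. generating_embedding A E B j \<longrightarrow>
        (\<exists>\<rho>. star_hom B C \<rho> \<and> \<rho> ` carrier B = carrier C \<and> (\<forall>x\<in>E. \<rho> (j x) = \<iota> x)))"

text \<open>\<open>E\<^sup>\<times>\<close> and \<open>E\<^sub>h\<^sup>\<times>\<close>, for \<open>E \<subseteq> A\<close> with \<open>C\<^sup>*\<close>-envelope \<open>(C, \<iota>)\<close>, as topological spaces.\<close>

definition inv_elems :: "'a set \<Rightarrow> 'c cstar \<Rightarrow> ('a \<Rightarrow> 'c) \<Rightarrow> 'a set" where
  "inv_elems E C \<iota> = {x \<in> E. \<iota> x \<in> Units C}"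

definition inv_space :: "'a cstar \<Rightarrow> 'a set \<Rightarrow> 'c cstar \<Rightarrow> ('a \<Rightarrow> 'c) \<Rightarrow> 'a topology" where
  "inv_space A E C \<iota> = subtopology (norm_topology A) (inv_elems E C \<iota>)"

definition herm_inv_space :: "'a cstar \<Rightarrow> 'a set \<Rightarrow> 'c cstar \<Rightarrow> ('a \<Rightarrow> 'c) \<Rightarrow> 'a topology" where
  "herm_inv_space A E C \<iota> =
     subtopology (norm_topology A) {x \<in> inv_elems E C \<iota>. star A x = x}"

definition induces_bij_on_pi0 :: "('a \<Rightarrow> 'b) \<Rightarrow> 'a topology \<Rightarrow> 'b set \<Rightarrow> bool" where
  "induces_bij_on_pi0 f X S \<longleftrightarrow>
     (\<exists>g. bij_betw g (path_components_of X) S \<and> (\<forall>P\<in>path_components_of X. \<forall>x\<in>P. g P = f x))"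


section \<open>Complex matrices\<close>

definition ctranspose :: "complex^'n^'m \<Rightarrow> complex^'m^'n" where
  "ctranspose A = map_matrix cnj (transpose A)"

text \<open>The norm is the operator norm with respect to the Euclidean norm, not the norm of the type
  \<open>complex^'n^'n\<close>.\<close>

definition mat_algebra :: "(complex^'n^'n) cstar" where
  "mat_algebra =
     \<lparr>carrier = UNIV, mult = (**), one = mat 1, zero = 0, add = (+),
      smult = (\<lambda>c. map_matrix ((*) c)),
      star = ctranspose, cnorm = (\<lambda>A. onorm ((*v) A))\<rparr>"

abbreviation M2 :: "(complex^2^2) cstar" where
  "M2 \<equiv> mat_algebra"

definition toeplitz2 :: "(complex^2^2) set" where
  "toeplitz2 = {vector [vector [t0, t1], vector [tm1, t0]] | tm1 t0 t1. True}"

definition char_polynomial :: "complex^'n^'n \<Rightarrow> complex poly" where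
  "char_polynomial A = det (mat [:0, 1:] - map_matrix (\<lambda>a. [:a:]) A)"

definition eigenvalue_mult :: "complex^'n^'n \<Rightarrow> complex \<Rightarrow> nat" where
  "eigenvalue_mult A a = Polynomial.order a (char_polynomial A)"

definition signature :: "complex^'n^'n \<Rightarrow> int" where
  "signature A =
     (\<Sum>r | r > 0 \<and> poly (char_polynomial A) (complex_of_real r) = 0.
        int (eigenvalue_mult A (complex_of_real r))) -
     (\<Sum>r | r < 0 \<and> poly (char_polynomial A) (complex_of_real r) = 0.
        int (eigenvalue_mult A (complex_of_real r)))"

end

theory Submission
  imports Defs
begin

text \<open>For the envelope, let \<open>j\<close> be a unital complete order embedding of the Toeplitz matrices into \<open>B\<close> and
  \<open>v = j(e\<^sub>1\<^sub>2)\<close>. For a unitary \<open>u\<close> the matrix with rows \<open>(1, u)\<close>, \<open>(u\<^sup>*, 1)\<close> is positive; applied to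
  \<open>e\<^sub>1\<^sub>2 + e\<^sub>2\<^sub>1\<close> and \<open>e\<^sub>1\<^sub>2 - e\<^sub>2\<^sub>1\<close> and added up, this gives \<open>v\<^sup>* v + v v\<^sup>* \<le> 1\<close>. A state \<open>\<phi>\<close> with
  \<open>\<phi>(v\<^sup>* v) = 1\<close> then satisfies \<open>\<phi>(v v\<^sup>*) = 0\<close> and \<open>\<phi>((v v)\<^sup>* (v v)) = 0\<close>, so in its GNS space the cyclic
  vector \<open>\<xi>\<close> and \<open>v \<xi>\<close> span a reducing subspace on which \<open>v\<close> acts as \<open>e\<^sub>1\<^sub>2\<close>. Such a state exists because
  the order embedding prevents \<open>-1\<close> from lying in the cone generated by the sums of squares and
  \<open>v\<^sup>* v - 1\<close>, and a maximal cone avoiding \<open>-1\<close> is a total ordering of the hermitian part.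

  For the components, hermitian matrices are points of a Minkowski space whose quadratic form is the
  determinant, and the signature distinguishes the timelike future, the timelike past and the
  spacelike region. Two invertible matrices are joined within the complex line through them, which
  meets the singular matrices in at most two points.\<close>

section \<open>Complex matrices as a \<open>C\<^sup>*\<close>-algebra\<close>

text \<open>The obstacle is that \<open>j\<close> transports only linear and order data, whereas a
  homomorphism on \<open>B\<close> has to respect products such as v* v, which need not lie in the
  image of \<open>j\<close>. Matrix positivity is the bridge, in both directions. From M_2 to
  \<open>B\<close>, a Schur complement turns a positive 2 x 2 matrix over the Toeplitz system into
  an inequality between products. From \<open>B\<close> back to M_2, a relation -1 = k + t (v* v -
  1) with \<open>k\<close> a sum of squares is rewritten as (t - 1) 1 = k + t v* v. The matrix with
  rows (t - 1, t w), (t v, t), where w = v*, is then a Gram matrix over \<open>B\<close>. Its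
  entries lie in the image of \<open>j\<close>, and the quadratic form of its preimage over M_2
  takes the value -1, which is impossible.

  No Hilbert space is constructed. Only the 2 x 2 compression given by the state is needed, and it
  is a homomorphism because its multiplicative domain is a C*-subalgebra containing the generators.
  Spectral theory is avoided as well: positivity in \<open>B\<close> means being a sum of squares,
  and the main analytic input is a square root of 1 - h for small Hermitian
  \<open>h\<close>.\<close>

lemma bounded_linear_matrix_vector: "bounded_linear ((*v) (A::complex^'n^'m))"
  by simp

lemma mat_algebra_simps [simp]:
  "carrier mat_algebra = UNIV" "monoid.mult mat_algebra = (**)" "one mat_algebra = mat 1"
  "zero mat_algebra = 0" "add mat_algebra = (+)" "smult mat_algebra = (\<lambda>c. map_matrix ((*) c))"
  "star mat_algebra = ctranspose" "cnorm mat_algebra = (\<lambda>A. onorm ((*v) A))"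
  by (simp_all add: mat_algebra_def)

lemma ctranspose_nth [simp]: "ctranspose A $ i $ j = cnj (A $ j $ i)"
  by (simp add: ctranspose_def map_matrix_def transpose_def)

lemma map_matrix_nth [simp]: "map_matrix f A $ i $ j = f (A $ i $ j)"
  by (simp add: map_matrix_def)

lemma inner_ctranspose:
  fixes A :: "complex^'n^'m"
  shows "(A *v x) \<bullet> y = x \<bullet> (ctranspose A *v y)"
proof -
  \<comment> \<open>The inner product of these types is the real part of the Hermitian one.\<close>
  have inner: "a \<bullet> b = Re (a * cnj b)" for a b :: complex
    by (simp add: inner_complex_def)
  have "(A *v x) \<bullet> y = (\<Sum>i\<in>UNIV. \<Sum>j\<in>UNIV. Re (A$i$j * x$j * cnj (y$i)))"
    by (simp add: inner_vec_def matrix_vector_mult_def inner sum_distrib_right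
        del: times_complex.sel)
  also have "\<dots> = (\<Sum>j\<in>UNIV. \<Sum>i\<in>UNIV. Re (A$i$j * x$j * cnj (y$i)))"
    by (rule sum.swap)
  also have "\<dots> = x \<bullet> (ctranspose A *v y)"
    by (simp add: inner_vec_def matrix_vector_mult_def inner sum_distrib_left mult_ac
        del: times_complex.sel)
  finally show ?thesis .
qed

text \<open>The substantial half of the C*-identity: the square of |A x| is the inner product of x
  with A* A x, and Cauchy-Schwarz bounds it by the norm of A* A times the square of |x|.\<close>

lemma onorm_ctranspose_le:
  fixes A :: "complex^'n^'m"
  shows "onorm ((*v) A) ^ 2 \<le> onorm ((*v) (ctranspose A ** A))"
proof -
  let ?N = "onorm ((*v) (ctranspose A ** A))"
  have N: "0 \<le> ?N"
    by (rule onorm_pos_le) simp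
  have "norm (A *v x) \<le> sqrt ?N * norm x" for x
  proof -
    have "(norm (A *v x))\<^sup>2 = x \<bullet> ((ctranspose A ** A) *v x)"
      by (simp add: power2_norm_eq_inner inner_ctranspose matrix_vector_mul_assoc)
    also have "\<dots> \<le> norm x * (?N * norm x)"
      by (rule order_trans[OF norm_cauchy_schwarz mult_left_mono[OF onorm]]) simp_all
    finally have "(norm (A *v x))\<^sup>2 \<le> (sqrt ?N * norm x)\<^sup>2"
      using N by (simp add: power_mult_distrib power2_eq_square algebra_simps)
    then show ?thesis
      by (rule power2_le_imp_le) (use N in simp)
  qed
  then have "onorm ((*v) A) \<le> sqrt ?N"
    by (rule onorm_le)
  then have "onorm ((*v) A) ^ 2 \<le> sqrt ?N ^ 2"
    by (rule power_mono) (simp add: onorm_pos_le)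
  then show ?thesis using N by simp
qed

lemma onorm_matrix_mult_le:
  fixes A :: "complex^'n^'m" and B :: "complex^'k^'n"
  shows "onorm ((*v) (A ** B)) \<le> onorm ((*v) A) * onorm ((*v) B)"
  using onorm_compose[OF bounded_linear_matrix_vector bounded_linear_matrix_vector, of A B]
  by (simp add: o_def matrix_vector_mul_assoc)

lemma ctranspose_ctranspose [simp]: "ctranspose (ctranspose A) = A"
  by (simp add: vec_eq_iff)

lemma ctranspose_mult: "ctranspose (A ** B) = ctranspose B ** ctranspose A"
  by (simp add: vec_eq_iff matrix_matrix_mult_def mult.commute)

lemma ctranspose_add: "ctranspose (A + B) = ctranspose A + ctranspose B"
  by (simp add: vec_eq_iff)

text \<open>The previous inequality and submultiplicativity give |A|^2 <= |A*| |A|. Cancelling |A|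
  leaves |A| <= |A*|, which is then also applied to A*.\<close>

lemma onorm_ctranspose:
  fixes A :: "complex^'n^'m"
  shows "onorm ((*v) (ctranspose A)) = onorm ((*v) A)"
proof -
  have le: "onorm ((*v) A) \<le> onorm ((*v) (ctranspose A))" for A :: "complex^'k^'l"
  proof -
    have "onorm ((*v) A) ^ 2 \<le> onorm ((*v) (ctranspose A)) * onorm ((*v) A)"
      using onorm_ctranspose_le[of A] onorm_matrix_mult_le[of "ctranspose A" A] by linarith
    moreover have "0 \<le> onorm ((*v) A)" "0 \<le> onorm ((*v) (ctranspose A))"
      by (simp_all add: onorm_pos_le)
    ultimately show ?thesis
      by (cases "onorm ((*v) A) = 0") (auto simp: power2_eq_square)
  qed
  show ?thesis
    using le[of A] le[of "ctranspose A"] by simp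
qed

lemma onorm_cstar:
  fixes A :: "complex^'n^'m"
  shows "onorm ((*v) (ctranspose A ** A)) = onorm ((*v) A) ^ 2"
  using onorm_ctranspose_le[of A] onorm_matrix_mult_le[of "ctranspose A" A]
  by (simp add: onorm_ctranspose power2_eq_square)

text \<open>Every entry is a coordinate of \<open>A\<close> applied to a basis vector, hence bounded
  by the operator norm. The constant is crude; together with \<open>onorm_le_norm\<close> it makes
  the two norms equivalent.\<close>

lemma norm_le_onorm:
  fixes A :: "complex^'n^'m"
  shows "norm A \<le> (real CARD('m) * real CARD('n)) * onorm ((*v) A)"
proof -
  have el: "norm (A $ i $ j) \<le> onorm ((*v) A)" for i j
  proof -
    have "norm (A $ i $ j) = norm ((A *v axis j 1) $ i)"
      by (simp add: matrix_vector_mult_def axis_def if_distrib[of "(*) _"] cong: if_cong)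
    also have "\<dots> \<le> norm (A *v axis j 1)"
      by (rule Finite_Cartesian_Product.norm_nth_le)
    also have "\<dots> \<le> onorm ((*v) A) * norm (axis j 1 :: complex^'n)"
      by (rule onorm) simp
    finally show ?thesis by simp
  qed
  have "norm A \<le> (\<Sum>i\<in>UNIV. norm (A $ i))"
    by (simp add: norm_vec_def L2_set_le_sum)
  also have "\<dots> \<le> (\<Sum>i\<in>(UNIV::'m set). \<Sum>j\<in>(UNIV::'n set). onorm ((*v) A))"
  proof (rule sum_mono)
    fix i
    have "norm (A $ i) \<le> (\<Sum>j\<in>UNIV. norm (A $ i $ j))"
      by (simp add: norm_vec_def L2_set_le_sum)
    also have "\<dots> \<le> (\<Sum>j\<in>(UNIV::'n set). onorm ((*v) A))"
      by (rule sum_mono) (rule el)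
    finally show "norm (A $ i) \<le> (\<Sum>j\<in>(UNIV::'n set). onorm ((*v) A))" .
  qed
  finally show ?thesis by (simp add: algebra_simps)
qed

lemma onorm_le_norm:
  "\<exists>C>0. \<forall>A::complex^'n^'m. onorm ((*v) A) \<le> C * norm A"
proof (intro exI conjI allI)
  fix A :: "complex^'n^'m"
  show "onorm ((*v) A) \<le> (real CARD('m) * real CARD('n)) * norm A"
  proof (rule onorm_le)
    fix x :: "complex^'n"
    have "norm (A *v x) \<le> (\<Sum>i\<in>UNIV. norm ((A *v x) $ i))"
      by (simp add: norm_vec_def L2_set_le_sum)
    also have "\<dots> \<le> (\<Sum>i\<in>(UNIV::'m set). \<Sum>j\<in>(UNIV::'n set). norm A * norm x)"
    proof (rule sum_mono)
      fix i
      have "norm ((A *v x) $ i) \<le> (\<Sum>j\<in>UNIV. norm (A $ i $ j * x $ j))"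
        by (simp add: matrix_vector_mult_def norm_sum)
      also have "\<dots> \<le> (\<Sum>j\<in>(UNIV::'n set). norm A * norm x)"
        unfolding norm_mult
        by (intro sum_mono mult_mono order_trans[OF Finite_Cartesian_Product.norm_nth_le
              Finite_Cartesian_Product.norm_nth_le] Finite_Cartesian_Product.norm_nth_le) auto
      finally show "norm ((A *v x) $ i) \<le> (\<Sum>j\<in>(UNIV::'n set). norm A * norm x)" .
    qed
    finally show "norm (A *v x) \<le> real CARD('m) * real CARD('n) * norm A * norm x"
      by (simp add: algebra_simps)
  qed
qed simp

lemma smult_matrix_vector: "map_matrix ((*) c) A *v x = c *s (A *v (x::complex^'n))"
  by (simp add: vec_eq_iff matrix_vector_mult_def sum_distrib_left mult.assoc)

section \<open>Ring structure, norm topology and completeness of matrices\<close>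

lemma ring_mat_algebra: "ring (mat_algebra :: (complex^'n^'n) cstar)"
proof (rule ringI)
  show "abelian_group (mat_algebra :: (complex^'n^'n) cstar)"
  proof (rule abelian_groupI)
    fix x :: "complex^'n^'n"
    show "\<exists>y\<in>carrier mat_algebra. y \<oplus>\<^bsub>mat_algebra\<^esub> x = \<zero>\<^bsub>mat_algebra\<^esub>"
      by (auto intro!: exI[of _ "- x"])
  qed (simp_all add: algebra_simps)
  show "Group.monoid (mat_algebra :: (complex^'n^'n) cstar)"
    by (rule monoidI) (simp_all add: matrix_mul_assoc)
qed (simp_all add: matrix_add_ldistrib, simp add: vec_eq_iff matrix_matrix_mult_def sum.distrib
    distrib_right)

lemma a_minus_mat_algebra [simp]: "A \<ominus>\<^bsub>mat_algebra\<^esub> B = A - B"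
proof -
  interpret ring "mat_algebra :: (complex^'n^'n) cstar" by (rule ring_mat_algebra)
  have "\<ominus>\<^bsub>mat_algebra\<^esub> B = - B"
    using minus_equality[of "- B" B] by simp
  then show ?thesis by (simp add: a_minus_def)
qed

lemma cdist_mat_algebra: "cdist mat_algebra A B = onorm ((*v) (A - B))"
  by (simp add: cdist_def)

lemma onorm_matrix_minus: "onorm ((*v) (A - B)) = onorm ((*v) (B - A))" for A B :: "complex^'n^'m"
proof -
  have "(*v) (A - B) = (\<lambda>x. - ((B - A) *v x))"
    by (simp add: fun_eq_iff matrix_vector_mult_diff_rdistrib)
  then show ?thesis by (simp add: onorm_neg)
qed

lemma onorm_matrix_triangle:
  "onorm ((*v) (A + B)) \<le> onorm ((*v) A) + onorm ((*v) B)" for A B :: "complex^'n^'m"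
proof -
  have "(*v) (A + B) = (\<lambda>x. A *v x + B *v x)"
    by (simp add: fun_eq_iff matrix_vector_mult_add_rdistrib)
  then show ?thesis using onorm_triangle[of "(*v) A" "(*v) B"] by simp
qed

lemma onorm_matrix_eq_0: "onorm ((*v) A) = 0 \<longleftrightarrow> A = 0" for A :: "complex^'n^'m"
  using onorm_eq_0[of "(*v) A"] matrix_eq[of A 0] by simp

lemma Metric_space_mat_algebra:
  "Metric_space UNIV (cdist (mat_algebra :: (complex^'n^'n) cstar))"
proof
  fix x y z :: "complex^'n^'n"
  show "cdist mat_algebra x z \<le> cdist mat_algebra x y + cdist mat_algebra y z"
    using onorm_matrix_triangle[of "x - y" "y - z"] by (simp add: cdist_mat_algebra)
  show "cdist mat_algebra x y = cdist mat_algebra y x"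
    unfolding cdist_mat_algebra by (rule onorm_matrix_minus)
qed (simp_all add: cdist_mat_algebra onorm_matrix_eq_0 onorm_pos_le)

text \<open>Each kind of ball contains one of the other kind, with radii rescaled by the comparison
  constants. Closed sets and paths can thereafter be treated in the topology of the type.\<close>

lemma norm_topology_mat_algebra:
  "norm_topology (mat_algebra :: (complex^'n^'n) cstar) = euclidean"
proof -
  interpret M: Metric_space UNIV "cdist (mat_algebra :: (complex^'n^'n) cstar)"
    by (rule Metric_space_mat_algebra)
  obtain C where C: "C > 0" "\<And>A::complex^'n^'n. onorm ((*v) A) \<le> C * norm A"
    using onorm_le_norm[where 'n='n and 'm='n] by blast
  define c where "c = real CARD('n) * real CARD('n)"
  have c: "c > 0" "\<And>A::complex^'n^'n. norm A \<le> c * onorm ((*v) A)"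
    using norm_le_onorm[where 'n='n and 'm='n] by (auto simp: c_def)
  have "M.mtopology = euclidean"
  proof (rule topology_eq[THEN iffD2], intro allI)
    fix S :: "(complex^'n^'n) set"
    have "(\<exists>r>0. M.mball x r \<subseteq> S) \<longleftrightarrow> (\<exists>e>0. ball x e \<subseteq> S)" for x
    proof
      assume "\<exists>r>0. M.mball x r \<subseteq> S"
      then obtain r where r: "r > 0" "M.mball x r \<subseteq> S" by blast
      have "ball x (r / C) \<subseteq> M.mball x r"
        using C(1) by (auto simp: cdist_mat_algebra dist_norm field_simps
            intro!: order_le_less_trans[OF C(2)])
      then show "\<exists>e>0. ball x e \<subseteq> S"
        using r C(1) by (intro exI[of _ "r / C"]) auto
    next
      assume "\<exists>e>0. ball x e \<subseteq> S"
      then obtain e where e: "e > 0" "ball x e \<subseteq> S" by blast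
      have "M.mball x (e / c) \<subseteq> ball x e"
        using c(1) by (auto simp: cdist_mat_algebra dist_norm field_simps
            intro!: order_le_less_trans[OF c(2)])
      then show "\<exists>r>0. M.mball x r \<subseteq> S"
        using e c(1) by (intro exI[of _ "e / c"]) auto
    qed
    then show "openin M.mtopology S = openin euclidean S"
      by (auto simp: M.openin_mtopology open_contains_ball)
  qed
  then show ?thesis by (simp add: norm_topology_def)
qed

lemma mcomplete_mat_algebra:
  "Metric_space.mcomplete UNIV (cdist (mat_algebra :: (complex^'n^'n) cstar))"
proof -
  interpret M: Metric_space UNIV "cdist (mat_algebra :: (complex^'n^'n) cstar)"
    by (rule Metric_space_mat_algebra)
  define c where "c = real CARD('n) * real CARD('n)"
  have c: "c > 0" "\<And>A::complex^'n^'n. norm A \<le> c * onorm ((*v) A)"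
    using norm_le_onorm[where 'n='n and 'm='n] by (auto simp: c_def)
  have top: "M.mtopology = euclidean"
    using norm_topology_mat_algebra[where 'n='n] by (simp add: norm_topology_def)
  show ?thesis unfolding M.mcomplete_def
  proof (intro allI impI)
    fix \<sigma> assume "M.MCauchy \<sigma>"
    then have \<sigma>: "\<exists>N. \<forall>n n'. N \<le> n \<longrightarrow> N \<le> n' \<longrightarrow> onorm ((*v) (\<sigma> n - \<sigma> n')) < e" if "e > 0" for e
      using that unfolding M.MCauchy_def cdist_mat_algebra by blast
    have "Cauchy \<sigma>"
    proof (rule metric_CauchyI)
      fix e :: real assume "e > 0"
      then obtain N where N: "\<And>n n'. N \<le> n \<Longrightarrow> N \<le> n' \<Longrightarrow> onorm ((*v) (\<sigma> n - \<sigma> n')) < e / c"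
        using \<sigma>[of "e / c"] c(1) by auto
      have "norm (\<sigma> m - \<sigma> n) < e" if "m \<ge> N" "n \<ge> N" for m n
        using N[OF that] c by (auto simp: field_simps intro!: order_le_less_trans[OF c(2)])
      then show "\<exists>M. \<forall>m\<ge>M. \<forall>n\<ge>M. dist (\<sigma> m) (\<sigma> n) < e"
        by (auto simp: dist_norm)
    qed
    then obtain l where "\<sigma> \<longlonglongrightarrow> l"
      using Cauchy_convergent convergent_def by blast
    then show "\<exists>x. limitin M.mtopology \<sigma> x sequentially"
      by (auto simp: top)
  qed
qed

lemma smult_matrix_mult_left: "map_matrix ((*) c) A ** B = map_matrix ((*) c) (A ** B)"
  for A B :: "complex^'n^'n"
  by (simp add: vec_eq_iff matrix_matrix_mult_def sum_distrib_left mult.assoc)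

lemma smult_matrix_mult_right: "A ** map_matrix ((*) c) B = map_matrix ((*) c) (A ** B)"
  for A B :: "complex^'n^'n"
  by (simp add: vec_eq_iff matrix_matrix_mult_def sum_distrib_left mult_ac)

lemma onorm_smult_matrix:
  fixes A :: "complex^'n^'m"
  shows "onorm ((*v) (map_matrix ((*) c) A)) = cmod c * onorm ((*v) A)"
proof -
  have le: "onorm ((*v) (map_matrix ((*) c) A)) \<le> cmod c * onorm ((*v) A)" for c and A :: "complex^'n^'m"
  proof (rule onorm_le)
    fix x :: "complex^'n"
    have "norm (map_matrix ((*) c) A *v x) = cmod c * norm (A *v x)"
      by (simp add: smult_matrix_vector norm_vec_def norm_mult L2_set_right_distrib)
    then show "norm (map_matrix ((*) c) A *v x) \<le> cmod c * onorm ((*v) A) * norm x"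
      using onorm[OF bounded_linear_matrix_vector, of A x] by (simp add: mult_left_mono mult.assoc)
  qed
  show ?thesis
  proof (cases "c = 0")
    case True
    have "map_matrix ((*) 0) A = 0" by (simp add: vec_eq_iff)
    with True show ?thesis by (simp add: onorm_matrix_eq_0)
  next
    case False
    \<comment> \<open>The reverse inequality is the first one applied to multiplication by 1 /
      c.\<close>
    have "map_matrix ((*) (1 / c)) (map_matrix ((*) c) A) = A"
      using False by (simp add: vec_eq_iff)
    then have "onorm ((*v) A) \<le> cmod (1 / c) * onorm ((*v) (map_matrix ((*) c) A))"
      using le[of "1 / c" "map_matrix ((*) c) A"] by simp
    then show ?thesis
      using le[of c A] False by (intro antisym) (auto simp: norm_divide field_simps)
  qed
qed

lemma unital_cstar_algebra_mat_algebra: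
  "unital_cstar_algebra (mat_algebra :: (complex^'n^'n) cstar)"
proof (rule unital_cstar_algebra.intro[OF ring_mat_algebra unital_cstar_algebra_axioms.intro],
    goal_cases)
  case (1 x c) show ?case by (simp)
next
  case (2 x c d) show ?case by (simp add: vec_eq_iff distrib_right)
next
  case (3 x y c) show ?case by (simp add: vec_eq_iff distrib_left)
next
  case (4 x c d) show ?case by (simp add: vec_eq_iff)
next
  case (5 x) show ?case by (simp add: vec_eq_iff)
next
  case (6 x y c) show ?case by (simp only: mat_algebra_simps smult_matrix_mult_left)
next
  case (7 x y c) show ?case by (simp only: mat_algebra_simps smult_matrix_mult_right)
next
  case (8 x) show ?case by (simp)
next
  case (9 x) show ?case by (simp)
next
  case (10 x y) show ?case by (simp add: ctranspose_add)
next
  case (11 x c) show ?case by (simp add: vec_eq_iff)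
next
  case (12 x y) show ?case by (simp only: mat_algebra_simps ctranspose_mult)
next
  case (13 x) show ?case by (simp add: onorm_pos_le)
next
  case (14 x) show ?case by (simp add: onorm_matrix_eq_0)
next
  case (15 x y) show ?case by (simp only: mat_algebra_simps onorm_matrix_triangle)
next
  case (16 x c) show ?case by (simp only: mat_algebra_simps onorm_smult_matrix)
next
  case (17 x y) show ?case by (simp only: mat_algebra_simps onorm_matrix_mult_le)
next
  case (18 x) show ?case by (simp only: mat_algebra_simps onorm_cstar)
next
  case 19 show ?case by (simp only: mat_algebra_simps mcomplete_mat_algebra)
qed

section \<open>Entrywise calculus and matrix units for 2 x 2 matrices\<close>

lemma matrix_eq_2: "A = B \<longleftrightarrow> A$1$1 = B$1$1 \<and> A$1$2 = B$1$2 \<and> A$2$1 = B$2$1 \<and> A$2$2 = B$2$2"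
  for A B :: "'a^2^2"
  by (auto simp: vec_eq_iff forall_2)

lemma matrix_mult_2_nth: "(A ** B)$i$j = A$i$1 * B$1$j + A$i$2 * B$2$j"
  for A B :: "complex^2^2"
  by (simp add: matrix_matrix_mult_def sum_2)

definition E12 :: "complex^2^2" where "E12 = vector [vector [0, 1], vector [0, 0]]"
definition E21 :: "complex^2^2" where "E21 = vector [vector [0, 0], vector [1, 0]]"

lemma E12_nth [simp]: "E12$1$1 = 0" "E12$1$2 = 1" "E12$2$1 = 0" "E12$2$2 = 0"
  and E21_nth [simp]: "E21$1$1 = 0" "E21$1$2 = 0" "E21$2$1 = 1" "E21$2$2 = 0"
  by (simp_all add: E12_def E21_def)

lemma mat_1_nth_2 [simp]: "(mat 1 :: complex^2^2)$1$1 = 1" "(mat 1 :: complex^2^2)$1$2 = 0"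
  "(mat 1 :: complex^2^2)$2$1 = 0" "(mat 1 :: complex^2^2)$2$2 = 1"
  by (simp_all add: mat_def)

text \<open>The operator norm is submultiplicative, and the comparison of norms transfers this to
  the norm of the type. It serves in \<open>closedin_mult_domain\<close>.\<close>

lemma norm_matrix_mult_le: "\<exists>C. \<forall>B. norm (A ** B) \<le> C * norm B \<and> norm (B ** A) \<le> C * norm B"
  for A :: "complex^'n^'n"
proof -
  obtain C where C: "C > 0" "\<And>A::complex^'n^'n. onorm ((*v) A) \<le> C * norm A"
    using onorm_le_norm by metis
  define c where "c = real CARD('n) * real CARD('n)"
  have c: "c \<ge> 0" "\<And>A::complex^'n^'n. norm A \<le> c * onorm ((*v) A)"
    using norm_le_onorm[where 'n='n and 'm='n] by (auto simp: c_def)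
  have *: "norm X \<le> (c * (onorm ((*v) A) * C)) * norm B"
    if "onorm ((*v) X) \<le> onorm ((*v) A) * onorm ((*v) B)" for X B :: "complex^'n^'n"
  proof -
    have "onorm ((*v) A) * onorm ((*v) B) \<le> onorm ((*v) A) * (C * norm B)"
      by (intro mult_left_mono C(2)) (simp add: onorm_pos_le)
    then have "c * onorm ((*v) X) \<le> c * (onorm ((*v) A) * (C * norm B))"
      using that c(1) by (intro mult_left_mono) auto
    then show ?thesis using c(2)[of X] by (simp add: mult.assoc)
  qed
  show ?thesis
  proof (intro exI[of _ "c * (onorm ((*v) A) * C)"] allI conjI *)
    fix B :: "complex^'n^'n"
    show "onorm ((*v) (A ** B)) \<le> onorm ((*v) A) * onorm ((*v) B)"
      by (rule onorm_matrix_mult_le)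
    show "onorm ((*v) (B ** A)) \<le> onorm ((*v) A) * onorm ((*v) B)"
      using onorm_matrix_mult_le[of B A] by (simp only: mult.commute)
  qed
qed

section \<open>Path components of invertible matrices\<close>

lemma induces_bij_on_pi0I:
  assumes S: "f ` topspace X = S"
    and f: "\<And>x y. \<lbrakk>x \<in> topspace X; y \<in> topspace X\<rbrakk> \<Longrightarrow> path_component_of X x y \<longleftrightarrow> f x = f y"
  shows "induces_bij_on_pi0 f X S"
proof -
  \<comment> \<open>Any representative will do, since \<open>f\<close> is constant on each path
    component.\<close>
  define g where "g P = f (SOME x. x \<in> P)" for P
  have g: "g P = f x" if P: "P \<in> path_components_of X" and x: "x \<in> P" for P x
  proof -
    obtain a where a: "a \<in> topspace X" "P = Collect (path_component_of X a)"
      using P by (auto simp: path_components_of_def)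
    have "(SOME x. x \<in> P) \<in> P" using x by (rule someI)
    then have "path_component_of X a (SOME x. x \<in> P)" "path_component_of X a x"
      using a x by auto
    then show ?thesis
      using f a(1) path_component_in_topspace unfolding g_def by metis
  qed
  have "bij_betw g (path_components_of X) S"
  proof (rule bij_betw_imageI)
    show "inj_on g (path_components_of X)"
    proof (rule inj_onI)
      fix P Q assume PQ: "P \<in> path_components_of X" "Q \<in> path_components_of X" "g P = g Q"
      then obtain a b where "a \<in> topspace X" "b \<in> topspace X"
          "P = Collect (path_component_of X a)" "Q = Collect (path_component_of X b)"
        by (auto simp: path_components_of_def)
      moreover from this have "f a = f b"
        using g[of P a] g[of Q b] PQ by (auto simp: path_component_of_refl)
      ultimately show "P = Q"
        using f[of a b] by (simp add: path_component_of_equiv)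
    qed
    show "g ` path_components_of X = S"
    proof -
      have "g ` path_components_of X = f ` topspace X"
        using g by (auto simp: path_components_of_def image_image path_component_of_refl
            intro!: image_cong)
      with S show ?thesis by simp
    qed
  qed
  with g show ?thesis
    unfolding induces_bij_on_pi0_def by blast
qed

lemma Units_mat_algebra: "Units (mat_algebra :: (complex^'n^'n) cstar) = {x. det x \<noteq> 0}"
  by (auto simp: Units_def invertible_det_nz[symmetric] invertible_def)

lemma inv_space_mat_algebra:
  "inv_space mat_algebra E mat_algebra (\<lambda>x. x) = top_of_set {x \<in> E. det x \<noteq> 0}"
  by (simp add: inv_space_def inv_elems_def Units_mat_algebra norm_topology_mat_algebra)

lemma herm_inv_space_mat_algebra:
  "herm_inv_space mat_algebra E mat_algebra (\<lambda>x. x)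
    = top_of_set {x \<in> E. det x \<noteq> 0 \<and> ctranspose x = x}"
  by (simp add: herm_inv_space_def inv_elems_def Units_mat_algebra norm_topology_mat_algebra conj_ac)

text \<open>The hypothesis asks \<open>E\<close> to contain the complex line through any two of its
  points. A real segment may be blocked by a singular matrix; in the complex line one goes around
  it.\<close>

lemma path_connected_invertible:
  fixes E :: "(complex^2^2) set"
  assumes E: "\<And>A B z. \<lbrakk>A \<in> E; B \<in> E\<rbrakk> \<Longrightarrow> A + map_matrix ((*) z) (B - A) \<in> E"
  shows "path_connected {A \<in> E. det A \<noteq> 0}" (is "path_connected ?S")
  unfolding path_connected_component
proof (intro ballI)
  fix A B assume A: "A \<in> ?S" and B: "B \<in> ?S"
  define f where "f z = A + map_matrix ((*) z) (B - A)" for z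
  \<comment> \<open>The determinant along the line as a polynomial in \<open>z\<close>: the outer
    coefficients are determinants, and the middle one is the polarization of det at \<open>A\<close>
    and \<open>B - A\<close>.\<close>
  define p where "p = [:det A, A$1$1 * (B$2$2 - A$2$2) + A$2$2 * (B$1$1 - A$1$1)
      - A$1$2 * (B$2$1 - A$2$1) - A$2$1 * (B$1$2 - A$1$2), det (B - A):]"
  have p: "det (f z) = poly p z" for z
    by (simp add: f_def p_def det_2 algebra_simps)
  \<comment> \<open>Its constant coefficient det A does not vanish.\<close>
  have "p \<noteq> 0"
    using A by (auto simp: p_def)
  then have "countable {z. poly p z = 0}"
    by (simp add: poly_roots_finite countable_finite)
  then have "path_connected (UNIV - {z. poly p z = 0})"
    using path_connected_complement_countable[of "{z. poly p z = 0}"] by (simp add: Compl_eq_Diff_UNIV)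
  moreover have "continuous_on (UNIV - {z. poly p z = 0}) f"
    unfolding f_def map_matrix_def by (intro continuous_intros)
  ultimately have "path_connected (f ` (UNIV - {z. poly p z = 0}))" (is "path_connected ?T")
    by (rule path_connected_continuous_image[rotated])
  moreover have "f 0 = A" "f 1 = B"
    by (simp_all add: f_def vec_eq_iff)
  then have "A \<in> ?T" "B \<in> ?T"
    using A B p[of 0] p[of 1] by force+
  moreover have "?T \<subseteq> ?S"
    using A B E p by (auto simp: f_def)
  ultimately show "path_component ?S A B"
    by (meson path_component_of_subset path_connected_component)
qed

section \<open>Toeplitz membership and signatures of 2 x 2 matrices\<close>

lemma toeplitz2_iff: "A \<in> toeplitz2 \<longleftrightarrow> A$1$1 = A$2$2"
proof
  assume "A$1$1 = A$2$2"
  then have "A = vector [vector [A$1$1, A$1$2], vector [A$2$1, A$1$1]]"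
    by (simp add: vec_eq_iff forall_2)
  then show "A \<in> toeplitz2"
    unfolding toeplitz2_def by blast
qed (auto simp: toeplitz2_def)

text \<open>The floor only converts the real number \<open>sgn r\<close> to an integer. A zero root
  counts neither in the signature nor on the right, and a double root is counted twice on both
  sides.\<close>

lemma signature_eq_of_roots:
  fixes A :: "complex^'n^'n"
  assumes A: "char_polynomial A = [:- of_real r, 1:] * [:- of_real s, 1:]"
  shows "signature A = \<lfloor>sgn r\<rfloor> + \<lfloor>sgn s\<rfloor>"
proof -
  have root: "poly (char_polynomial A) (of_real x) = 0 \<longleftrightarrow> x = r \<or> x = s" for x
  proof -
    have "poly (char_polynomial A) (of_real x) = of_real ((x - r) * (x - s))"
      by (simp add: A algebra_simps)
    then show ?thesis by (simp del: of_real_mult)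
  qed
  \<comment> \<open>For \<open>r = s\<close> both summands can be 1, giving the multiplicity of a
    double root.\<close>
  have mult: "int (eigenvalue_mult A (of_real x)) = (if x = r then 1 else 0) + (if x = s then 1 else 0)" for x
  proof -
    have lin: "Polynomial.order (of_real x) [:- of_real y, 1 :: complex:] = (if x = y then 1 else 0)" for y
      using order_power_n_n[of "complex_of_real y" 1]
      by (auto intro!: order_0I simp: eq_neg_iff_add_eq_0 simp flip: of_real_minus of_real_add)
    show ?thesis
      unfolding eigenvalue_mult_def A by (subst order_mult) (simp_all add: lin)
  qed
  have sum: "(\<Sum>x | P x \<and> poly (char_polynomial A) (of_real x) = 0. int (eigenvalue_mult A (of_real x)))
      = (if P r then 1 else 0) + (if P s then 1 else 0)" for P :: "real \<Rightarrow> bool"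
  proof -
    have "{x. P x \<and> poly (char_polynomial A) (of_real x) = 0} = {x \<in> {r, s}. P x}"
      using root by auto
    then show ?thesis
      by (simp add: mult sum.distrib flip: sum.inter_filter)
  qed
  show ?thesis
    using floor_of_int[of "- 1", where 'a=real]
    unfolding signature_def sum by (auto simp: sgn_if)
qed

text \<open>The trace is 2 m and the determinant is m^2 - r^2, so the eigenvalues are m + r and m -
  r. In Minkowski space m is the time coordinate, (z, b) the spatial part and r its length.\<close>

lemma signature_hermitian:
  fixes b :: complex and m z :: real and A :: "complex^2^2"
  assumes A: "A = vector [vector [of_real (m + z), b], vector [cnj b, of_real (m - z)]]"
  defines "r \<equiv> norm (z, b)"
  assumes ne: "\<bar>m\<bar> \<noteq> r"
  shows "signature A = (if \<bar>m\<bar> < r then 0 else if m > 0 then 2 else - 2)"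
proof -
  have r2: "r\<^sup>2 = z\<^sup>2 + (cmod b)\<^sup>2" "r \<ge> 0"
    by (simp_all add: r_def norm_prod_def)
  have "complex_of_real (r\<^sup>2) = of_real z ^ 2 + b * cnj b"
    by (simp add: r2 flip: complex_norm_square)
  then have "char_polynomial A = [:- of_real (m + r), 1:] * [:- of_real (m - r), 1:]"
    unfolding char_polynomial_def A
    by (simp add: det_2 mat_def algebra_simps power2_eq_square)
  from signature_eq_of_roots[OF this] show ?thesis
    using ne r2(2) floor_of_int[of "- 1", where 'a=real] by (auto simp: sgn_if)
qed

section \<open>Regions of Minkowski space and their images among Hermitian matrices\<close>

lemma path_connected_hyperboloid_regions:
  assumes "2 \<le> DIM('v::euclidean_space)"
  shows "path_connected {(m::real, w::'v). \<bar>m\<bar> < norm w}"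
    and "path_connected {(m::real, w::'v). norm w < m}"
    and "path_connected {(m::real, w::'v). norm w < - m}"
proof -
  \<comment> \<open>The dimension hypothesis enters here: on a line the punctured space, and with it
    the spacelike region, would fall into two pieces.\<close>
  have "path_connected (- {0::'v})"
    by (rule path_connected_punctured_universe[OF assms])
  then have "path_connected ({-1<..<1::real} \<times> (- {0::'v}))"
    by (intro path_connected_Times) (auto intro: convex_imp_path_connected)
  \<comment> \<open>The parameter \<open>t\<close> is the slope m / |w|, so that |m| < |w| becomes
    |t| < 1.\<close>
  then have "path_connected ((\<lambda>(t, w). (t * norm w, w)) ` ({-1<..<1::real} \<times> (- {0::'v})))"
    by (rule path_connected_continuous_image[rotated])
       (auto simp: case_prod_unfold intro!: continuous_intros)
  also have "(\<lambda>(t, w). (t * norm w, w)) ` ({-1<..<1::real} \<times> (- {0::'v}))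
      = {(m, w). \<bar>m\<bar> < norm w}"
  proof (intro subset_antisym subsetI)
    fix p :: "real \<times> 'v" assume "p \<in> {(m, w). \<bar>m\<bar> < norm w}"
    moreover from this have "norm (snd p) > 0" by auto
    ultimately show "p \<in> (\<lambda>(t, w). (t * norm w, w)) ` ({-1<..<1::real} \<times> (- {0::'v}))"
      by (intro image_eqI[of _ _ "(fst p / norm (snd p), snd p)"])
        (auto simp: pos_divide_less_eq pos_less_divide_eq abs_less_iff)
  next
    fix p :: "real \<times> 'v" assume "p \<in> (\<lambda>(t, w). (t * norm w, w)) ` ({-1<..<1::real} \<times> (- {0::'v}))"
    then obtain q where q: "q \<in> {-1<..<1::real} \<times> (- {0::'v})" "p = (fst q * norm (snd q), snd q)"
      by (metis (no_types, lifting) imageE case_prod_unfold)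
    then have "\<bar>fst q\<bar> < 1" "snd q \<noteq> 0"
      by (auto simp: abs_less_iff mem_Times_iff)
    with q show "p \<in> {(m, w). \<bar>m\<bar> < norm w}"
      by (simp add: abs_mult mult_less_cancel_right1)
  qed
  finally show "path_connected {(m::real, w::'v). \<bar>m\<bar> < norm w}" .
  have pos: "path_connected ({0::real<..} \<times> (UNIV :: 'v set))"
    by (intro path_connected_Times) (auto intro: convex_imp_path_connected)
  \<comment> \<open>A future timelike point is given by its spatial part and its height
    \<open>t\<close> above the light cone; the past is treated likewise.\<close>
  have "path_connected ((\<lambda>(t, w). (norm w + t, w)) ` ({0::real<..} \<times> (UNIV :: 'v set)))"
    by (rule path_connected_continuous_image[OF _ pos])
       (auto simp: case_prod_unfold intro!: continuous_intros)
  also have "(\<lambda>(t, w). (norm w + t, w)) ` ({0::real<..} \<times> (UNIV :: 'v set)) = {(m, w). norm w < m}"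
    by (auto intro!: image_eqI[of _ _ "(m - norm w, w)" for m w])
  finally show "path_connected {(m::real, w::'v). norm w < m}" .
  have "path_connected ((\<lambda>(t, w). (- norm w - t, w)) ` ({0::real<..} \<times> (UNIV :: 'v set)))"
    by (rule path_connected_continuous_image[OF _ pos])
       (auto simp: case_prod_unfold intro!: continuous_intros)
  also have "(\<lambda>(t, w). (- norm w - t, w)) ` ({0::real<..} \<times> (UNIV :: 'v set)) = {(m, w). norm w < - m}"
    by (auto intro!: image_eqI[of _ _ "(- m - norm w, w)" for m w])
  finally show "path_connected {(m::real, w::'v). norm w < - m}" .
qed

text \<open>One statement serves both spaces, with spatial dimension 3 for \<open>M2\<close> and 2
  for the Toeplitz matrices. The map \<open>h\<close> is a chart, and its continuous left inverse
  \<open>k\<close> carries paths of matrices back to Minkowski space.\<close>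

lemma induces_bij_on_pi0_minkowski:
  fixes h :: "real \<times> 'v::euclidean_space \<Rightarrow> 'a::topological_space" and f :: "'a \<Rightarrow> int"
  assumes dim: "2 \<le> DIM('v)"
    and h: "continuous_on UNIV h" and k: "continuous_on UNIV k" "\<And>p. k (h p) = p"
    and f: "\<And>m w. \<bar>m\<bar> \<noteq> norm w \<Longrightarrow>
              f (h (m, w)) = (if \<bar>m\<bar> < norm w then 0 else if m > 0 then 2 else - 2)"
  shows "induces_bij_on_pi0 f (top_of_set (h ` {(m, w). \<bar>m\<bar> \<noteq> norm w})) {- 2, 0, 2}"
    (is "induces_bij_on_pi0 f (top_of_set (h ` ?L)) _")
proof (rule induces_bij_on_pi0I)
  obtain e :: 'v where e: "norm e = 1"
    using norm_Basis nonempty_Basis by blast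
  show "f ` topspace (top_of_set (h ` ?L)) = {- 2, 0, 2}"
  proof
    show "f ` topspace (top_of_set (h ` ?L)) \<subseteq> {- 2, 0, 2}"
      using f by (auto split: if_splits)
    \<comment> \<open>One point from each region: spacelike, future, past.\<close>
    have "(0, e) \<in> ?L" "(2, e) \<in> ?L" "(- 2, e) \<in> ?L" using e by auto
    moreover have "f (h (0, e)) = 0" "f (h (2, e)) = 2" "f (h (- 2, e)) = - 2"
      using f[of _ e] e by auto
    ultimately show "{- 2, 0, 2} \<subseteq> f ` topspace (top_of_set (h ` ?L))"
      by simp
  qed
next
  fix x y assume "x \<in> topspace (top_of_set (h ` ?L))" "y \<in> topspace (top_of_set (h ` ?L))"
  then obtain p q where p: "p \<in> ?L" "x = h p" and q: "q \<in> ?L" "y = h q" by auto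
  define n :: "real \<times> 'v \<Rightarrow> real" where "n p = norm (snd p)" for p
  have fh: "f (h p) = (if \<bar>fst p\<bar> < n p then 0 else if fst p > 0 then 2 else - 2)" if "p \<in> ?L" for p
    using f[of "fst p" "snd p"] that by (auto simp: n_def)
  have "path_component (h ` ?L) x y \<longleftrightarrow> f x = f y"
  proof
    assume "path_component (h ` ?L) x y"
    then obtain g where g: "path g" "path_image g \<subseteq> h ` ?L" "pathstart g = x" "pathfinish g = y"
      by (auto simp: path_component_def)
    define C where "C = k ` path_image g"
    have "connected C"
      unfolding C_def using connected_path_image[OF g(1)] continuous_on_subset[OF k(1)]
      by (intro connected_continuous_image) auto
    have CL: "C \<subseteq> ?L"
      using g(2) k(2) by (auto simp: C_def)
    have C: "p \<in> C" "q \<in> C"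
      using g(3,4) p q k(2) pathstart_in_path_image[of g] pathfinish_in_path_image[of g]
      unfolding C_def by (metis image_eqI)+
    \<comment> \<open>A continuous real function without zeros on a connected set has constant
      sign.\<close>
    have same: "\<phi> a > 0 \<longleftrightarrow> \<phi> b > 0"
      if "continuous_on C \<phi>" "\<And>c. c \<in> C \<Longrightarrow> \<phi> c \<noteq> 0" "a \<in> C" "b \<in> C"
      for \<phi> :: "real \<times> 'v \<Rightarrow> real" and a b
    proof -
      have "connected (\<phi> ` C)"
        using that(1) \<open>connected C\<close> by (rule connected_continuous_image)
      then have "is_interval (\<phi> ` C)" by (simp add: is_interval_connected_1)
      moreover have "\<phi> a \<in> \<phi> ` C" "\<phi> b \<in> \<phi> ` C" "0 \<notin> \<phi> ` C"
        using that by force+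
      ultimately show ?thesis
        unfolding is_interval_1 by (metis linorder_not_less order_le_less)
    qed
    \<comment> \<open>The difference |w| - |m| never vanishes on \<open>C\<close>; its sign
      separates spacelike from timelike points.\<close>
    have 1: "n a - \<bar>fst a\<bar> > 0 \<longleftrightarrow> n b - \<bar>fst b\<bar> > 0" if "a \<in> C" "b \<in> C" for a b
      using CL that by (intro same[of "\<lambda>p. n p - \<bar>fst p\<bar>"])
        (auto simp: n_def intro!: continuous_intros)
    \<comment> \<open>Off the spacelike region |m| > |w| >= 0, so m itself has no zero along the
      path and separates future from past.\<close>
    have 2: "fst p > 0 \<longleftrightarrow> fst q > 0" if "\<not> n p - \<bar>fst p\<bar> > 0"
    proof (rule same[of fst])
      fix c assume c: "c \<in> C"
      then have "n c < \<bar>fst c\<bar>"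
        using that 1[OF C(1) c] CL by (auto simp: n_def)
      then show "fst c \<noteq> 0"
        using norm_ge_zero[of "snd c"] by (auto simp: n_def)
    qed (intro continuous_intros C)+
    show "f x = f y"
      using 1[OF C] 2 fh[OF p(1)] fh[OF q(1)] p q by auto
  next
    assume eq: "f x = f y"
    have via: "path_component (h ` ?L) x y"
      if T: "path_connected T" "T \<subseteq> ?L" "p \<in> T" "q \<in> T" for T
    proof -
      have "path_connected (h ` T)"
        using T(1) continuous_on_subset[OF h] by (intro path_connected_continuous_image) auto
      then have "path_component (h ` T) x y"
        using T p q by (auto simp: path_connected_component)
      then show ?thesis
        using T(2) by (meson image_mono path_component_of_subset)
    qed
    note R = path_connected_hyperboloid_regions[OF dim]
    consider "\<bar>fst p\<bar> < n p" "\<bar>fst q\<bar> < n q" | "fst p > n p" "fst q > n q" | "- fst p > n p" "- fst q > n q"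
      using p q eq fh[OF p(1)] fh[OF q(1)] norm_ge_zero[of "snd p"] norm_ge_zero[of "snd q"]
      by (fastforce simp: n_def split: if_splits)
    then show "path_component (h ` ?L) x y"
    proof cases
      case 1 then show ?thesis by (intro via[OF R(1)]) (auto simp: n_def)
    next
      case 2 then show ?thesis by (intro via[OF R(2)]) (auto simp: n_def)
    next
      case 3 then show ?thesis by (intro via[OF R(3)]) (auto simp: n_def)
    qed
  qed
  then show "path_component_of (top_of_set (h ` ?L)) x y \<longleftrightarrow> f x = f y"
    by simp
qed

lemma continuous_on_vector_2:
  assumes "continuous_on S f" "continuous_on S g"
  shows "continuous_on S (\<lambda>x. vector [f x, g x] :: ('a::real_normed_vector)^2)"
proof -
  have "(\<lambda>x. vector [f x, g x] :: 'a^2) = (\<lambda>x. \<chi> i. if i = 1 then f x else g x)"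
    by (simp add: fun_eq_iff vec_eq_iff forall_2)
  then show ?thesis
    using assms by (simp only:) (rule continuous_on_vec_lambda, case_tac "i = 1", simp_all)
qed

lemma hermitian_2_iff:
  fixes A :: "complex^2^2"
  shows "ctranspose A = A \<longleftrightarrow> Im (A$1$1) = 0 \<and> Im (A$2$2) = 0 \<and> A$2$1 = cnj (A$1$2)"
proof -
  have real: "cnj z = z \<longleftrightarrow> Im z = 0" for z
    by (auto simp: complex_eq_iff)
  have "ctranspose A = A \<longleftrightarrow>
      cnj (A$1$1) = A$1$1 \<and> cnj (A$2$1) = A$1$2 \<and> cnj (A$1$2) = A$2$1 \<and> cnj (A$2$2) = A$2$2"
    by (simp add: vec_eq_iff forall_2 conj_assoc)
  then show ?thesis
    unfolding real by (metis complex_cnj_cnj)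
qed

text \<open>The coordinates are those with respect to the identity and the Pauli matrices; in them
  the determinant is m^2 - |w|^2.\<close>

lemma signature_pi0_M2:
  "induces_bij_on_pi0 signature (herm_inv_space M2 (carrier M2) M2 (\<lambda>x. x)) {- 2, 0, 2}"
proof -
  define h :: "real \<times> (real \<times> complex) \<Rightarrow> complex^2^2" where
    "h = (\<lambda>(m, z, b). vector [vector [of_real (m + z), b], vector [cnj b, of_real (m - z)]])"
  define k :: "complex^2^2 \<Rightarrow> real \<times> (real \<times> complex)" where
    "k A = ((Re (A$1$1) + Re (A$2$2)) / 2, (Re (A$1$1) - Re (A$2$2)) / 2, A$1$2)" for A
  have "induces_bij_on_pi0 signature (top_of_set (h ` {(m, w). \<bar>m\<bar> \<noteq> norm w})) {- 2, 0, 2}"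
  proof (rule induces_bij_on_pi0_minkowski)
    show "continuous_on UNIV h"
      unfolding h_def case_prod_unfold by (intro continuous_on_vector_2 continuous_intros)
    show "continuous_on UNIV k"
      unfolding k_def by (intro continuous_intros) auto
    show "k (h p) = p" for p
      by (cases p) (simp add: k_def h_def)
    show "signature (h (m, w)) = (if \<bar>m\<bar> < norm w then 0 else if m > 0 then 2 else - 2)"
      if "\<bar>m\<bar> \<noteq> norm w" for m w
      using that signature_hermitian[OF refl, of m "fst w" "snd w"] by (simp add: h_def case_prod_unfold)
  qed simp
  also have "h ` {(m, w). \<bar>m\<bar> \<noteq> norm w} = {A. det A \<noteq> 0 \<and> ctranspose A = A}"
  proof -
    have det: "det (h (m, w)) = 0 \<longleftrightarrow> \<bar>m\<bar> = norm w" for m w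
    proof -
      have "det (h (m, w)) = of_real (m\<^sup>2 - (norm w)\<^sup>2)"
        using complex_norm_square[of "snd w"]
        by (simp add: h_def case_prod_unfold det_2 norm_prod_def algebra_simps power2_eq_square)
      then have "det (h (m, w)) = 0 \<longleftrightarrow> m\<^sup>2 = (norm w)\<^sup>2"
        by (simp del: of_real_diff)
      then show ?thesis
        using norm_ge_zero[of w] by (auto simp: power2_eq_iff abs_if)
    qed
    have "ctranspose (h p) = h p" for p
      by (simp add: h_def case_prod_unfold vec_eq_iff forall_2)
    moreover have "A = h (k A)" if "ctranspose A = A" for A
      using that unfolding hermitian_2_iff
      by (simp add: h_def k_def vec_eq_iff forall_2 complex_eq_iff) (simp add: field_simps)
    ultimately show ?thesis
      using det by (intro subset_antisym subsetI; clarsimp) (metis (mono_tags, lifting) image_eqI mem_Collect_eq case_prod_conv surj_pair)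
  qed
  finally show ?thesis
    by (simp add: herm_inv_space_mat_algebra)
qed

text \<open>The Toeplitz condition cuts out the hyperplane z = 0 of the coordinates used for
  \<open>M2\<close>, which leaves two spatial dimensions.\<close>

lemma signature_pi0_toeplitz2:
  "induces_bij_on_pi0 signature (herm_inv_space M2 toeplitz2 M2 (\<lambda>x. x)) {- 2, 0, 2}"
proof -
  define h :: "real \<times> complex \<Rightarrow> complex^2^2" where
    "h = (\<lambda>(m, b). vector [vector [of_real m, b], vector [cnj b, of_real m]])"
  define k :: "complex^2^2 \<Rightarrow> real \<times> complex" where
    "k A = (Re (A$1$1), A$1$2)" for A
  have "induces_bij_on_pi0 signature (top_of_set (h ` {(m, w). \<bar>m\<bar> \<noteq> norm w})) {- 2, 0, 2}"
  proof (rule induces_bij_on_pi0_minkowski)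
    show "continuous_on UNIV h"
      unfolding h_def case_prod_unfold by (intro continuous_on_vector_2 continuous_intros)
    show "continuous_on UNIV k"
      unfolding k_def by (intro continuous_intros)
    show "k (h p) = p" for p
      by (cases p) (simp add: k_def h_def)
    show "signature (h (m, w)) = (if \<bar>m\<bar> < norm w then 0 else if m > 0 then 2 else - 2)"
      if "\<bar>m\<bar> \<noteq> norm w" for m w
      using that signature_hermitian[OF refl, of m 0 w] by (simp add: h_def norm_prod_def)
  qed simp
  also have "h ` {(m, w). \<bar>m\<bar> \<noteq> norm w} = {A \<in> toeplitz2. det A \<noteq> 0 \<and> ctranspose A = A}"
  proof -
    have det: "det (h (m, w)) = 0 \<longleftrightarrow> \<bar>m\<bar> = norm w" for m w
    proof -
      have "det (h (m, w)) = of_real (m\<^sup>2 - (norm w)\<^sup>2)"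
        using complex_norm_square[of w]
        by (simp add: h_def det_2 power2_eq_square)
      then have "det (h (m, w)) = 0 \<longleftrightarrow> m\<^sup>2 = (norm w)\<^sup>2"
        by (simp del: of_real_diff)
      then show ?thesis
        using norm_ge_zero[of w] by (auto simp: power2_eq_iff abs_if)
    qed
    have "ctranspose (h p) = h p" "h p \<in> toeplitz2" for p
      by (simp_all add: h_def case_prod_unfold vec_eq_iff forall_2 toeplitz2_iff)
    moreover have "A = h (k A)" if "ctranspose A = A" "A \<in> toeplitz2" for A
      using that unfolding hermitian_2_iff
      by (simp add: h_def k_def vec_eq_iff forall_2 complex_eq_iff toeplitz2_iff)
    ultimately show ?thesis
      using det by (intro subset_antisym subsetI; clarsimp) (metis (mono_tags, lifting) image_eqI mem_Collect_eq case_prod_conv surj_pair)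
  qed
  finally show ?thesis
    by (simp add: herm_inv_space_mat_algebra)
qed

lemma path_connected_inv_space:
  assumes "\<And>A B z. \<lbrakk>A \<in> E; B \<in> E\<rbrakk> \<Longrightarrow> A + map_matrix ((*) z) (B - A) \<in> E" and "mat 1 \<in> E"
  shows "is_singleton (path_components_of (inv_space M2 E M2 (\<lambda>x. x)))
    \<and> path_connected_space (inv_space M2 E M2 (\<lambda>x. x))"
proof -
  have conn: "path_connected_space (inv_space M2 E M2 (\<lambda>x. x))"
    using path_connected_invertible[OF assms(1)] by (simp add: inv_space_mat_algebra)
  \<comment> \<open>The empty space would have no component at all, so a point has to be
    exhibited.\<close>
  have "mat 1 \<in> topspace (inv_space M2 E M2 (\<lambda>x. x))"
    using assms(2) by (simp add: inv_space_mat_algebra)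
  with conn have "path_components_of (inv_space M2 E M2 (\<lambda>x. x)) = {topspace (inv_space M2 E M2 (\<lambda>x. x))}"
    unfolding path_components_of_eq_singleton by blast
  with conn show ?thesis
    by (metis is_singletonI)
qed

lemma path_connected_inv_space_M2:
  "is_singleton (path_components_of (inv_space M2 (carrier M2) M2 (\<lambda>x. x)))
    \<and> path_connected_space (inv_space M2 (carrier M2) M2 (\<lambda>x. x))"
  by (rule path_connected_inv_space) simp_all

lemma path_connected_inv_space_toeplitz2:
  "is_singleton (path_components_of (inv_space M2 toeplitz2 M2 (\<lambda>x. x)))
    \<and> path_connected_space (inv_space M2 toeplitz2 M2 (\<lambda>x. x))"
  by (rule path_connected_inv_space) (simp_all add: toeplitz2_iff mat_def)

section \<open>Sums of squares and states\<close>

lemma (in abelian_monoid) finsum_lessThan_Suc: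
  "f \<in> {..<Suc n} \<rightarrow> carrier G \<Longrightarrow> (\<Oplus>k\<in>{..<Suc n}. f k) = f n \<oplus> (\<Oplus>k\<in>{..<n}. f k)"
  unfolding lessThan_Suc by (rule finsum_insert) auto

context unital_cstar_algebra
begin

section \<open>Scalars, involution and norm in a unital C*-algebra\<close>

declare smult_closed [simp, intro] star_closed [simp, intro]

lemma smult_zero_left [simp]: "x \<in> carrier A \<Longrightarrow> 0 \<odot> x = \<zero>"
  using smult_l_distr[of x 0 0] by (metis add.l_cancel_one' add_0 smult_closed)

lemma smult_zero_right [simp]: "c \<odot> \<zero> = \<zero>"
  using smult_r_distr[of \<zero> \<zero> c] by (metis add.l_cancel_one' l_zero smult_closed zero_closed)

lemma smult_minus_one: "x \<in> carrier A \<Longrightarrow> (- 1) \<odot> x = \<ominus> x"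
  using smult_l_distr[of x "- 1" 1]
  by (metis add.inv_equality add.left_inverse smult_closed smult_one smult_zero_left)

lemma smult_minus_left: "x \<in> carrier A \<Longrightarrow> (- c) \<odot> x = \<ominus> (c \<odot> x)"
  using smult_assoc[of x "- 1" c] smult_minus_one[of "c \<odot> x"] by simp

lemma smult_minus_right: "x \<in> carrier A \<Longrightarrow> c \<odot> (\<ominus> x) = \<ominus> (c \<odot> x)"
  using smult_assoc[of x c "- 1"] smult_minus_one[of x] smult_minus_left[of x c] by simp

lemma smult_diff_right:
  "\<lbrakk>x \<in> carrier A; y \<in> carrier A\<rbrakk> \<Longrightarrow> c \<odot> (x \<ominus> y) = c \<odot> x \<ominus> c \<odot> y"
  by (simp add: a_minus_def smult_r_distr smult_minus_right)

lemma smult_half_double: "x \<in> carrier A \<Longrightarrow> (1/2) \<odot> x \<oplus> (1/2) \<odot> x = x"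
  using smult_l_distr[of x "1/2" "1/2"] smult_one by simp

lemma star_zero [simp]: "star A \<zero> = \<zero>"
  using star_add[of \<zero> \<zero>] by (metis add.l_cancel_one' l_zero star_closed zero_closed)

lemma star_one [simp]: "star A \<one> = \<one>"
  using star_mult[of "star A \<one>" \<one>] by (metis l_one one_closed r_one star_closed star_star)

lemma star_minus: "x \<in> carrier A \<Longrightarrow> star A (\<ominus> x) = \<ominus> star A x"
  using star_smult[of x "- 1"] by (simp add: smult_minus_one)

lemma star_diff:
  "\<lbrakk>x \<in> carrier A; y \<in> carrier A\<rbrakk> \<Longrightarrow> star A (x \<ominus> y) = star A x \<ominus> star A y"
  by (simp add: a_minus_def star_add star_minus)

lemma cnorm_zero [simp]: "cnorm A \<zero> = 0"
  by (simp add: cnorm_eq_zero)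

lemma cnorm_minus: "x \<in> carrier A \<Longrightarrow> cnorm A (\<ominus> x) = cnorm A x"
  using cnorm_smult[of x "- 1"] by (simp add: smult_minus_one)

lemma minus_diff: "\<lbrakk>x \<in> carrier A; y \<in> carrier A\<rbrakk> \<Longrightarrow> \<ominus> (x \<ominus> y) = y \<ominus> x"
  by algebra

lemma cnorm_diff_commute:
  "\<lbrakk>x \<in> carrier A; y \<in> carrier A\<rbrakk> \<Longrightarrow> cnorm A (x \<ominus> y) = cnorm A (y \<ominus> x)"
  using cnorm_minus[of "x \<ominus> y"] minus_diff by simp

lemma cnorm_diff_triangle:
  assumes "x \<in> carrier A" "y \<in> carrier A" "z \<in> carrier A"
  shows "cnorm A (x \<ominus> z) \<le> cnorm A (x \<ominus> y) + cnorm A (y \<ominus> z)"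
proof -
  have "x \<ominus> z = (x \<ominus> y) \<oplus> (y \<ominus> z)"
    using assms by algebra
  then show ?thesis
    using assms cnorm_triangle[of "x \<ominus> y" "y \<ominus> z"] by simp
qed

text \<open>As for matrices, the C*-identity gives |x|^2 <= |x*| |x|, and |x| is cancelled.\<close>

lemma cnorm_star:
  assumes "x \<in> carrier A"
  shows "cnorm A (star A x) = cnorm A x"
proof -
  have le: "cnorm A x \<le> cnorm A (star A x)" if "x \<in> carrier A" for x
  proof (cases "cnorm A x = 0")
    case False
    have "(cnorm A x)\<^sup>2 \<le> cnorm A (star A x) * cnorm A x"
      using cstar_identity[OF that] cnorm_mult[of "star A x" x] that by simp
    then show ?thesis
      using False cnorm_nonneg[OF that] by (simp add: power2_eq_square)
  qed (use cnorm_nonneg that in simp)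
  show ?thesis
    using le[OF assms] le[of "star A x"] assms by (simp add: star_star)
qed

lemma diff_eq_zero_iff:
  assumes "x \<in> carrier A" "y \<in> carrier A"
  shows "x \<ominus> y = \<zero> \<longleftrightarrow> x = y"
proof
  have "x = (x \<ominus> y) \<oplus> y" using assms by algebra
  then show "x = y" if "x \<ominus> y = \<zero>" using that assms by simp
qed (use assms in \<open>simp add: a_minus_def r_neg\<close>)

lemma Metric_space_cdist: "Metric_space (carrier A) (cdist A)"
proof
  fix x y z
  show "cdist A x z \<le> cdist A x y + cdist A y z"
    if "x \<in> carrier A" "y \<in> carrier A" "z \<in> carrier A"
    using that cnorm_diff_triangle by (simp add: cdist_def)
  show "cdist A x y = 0 \<longleftrightarrow> x = y" if "x \<in> carrier A" "y \<in> carrier A"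
    using that by (simp add: cdist_def cnorm_eq_zero diff_eq_zero_iff)
qed (auto simp: cdist_def cnorm_nonneg cnorm_diff_commute)

text \<open>Additivity and the bound make \<open>F\<close> continuous. The lemma is applied to maps
  measuring the failure of multiplicativity.\<close>

lemma closedin_kernel:
  fixes F :: "'a \<Rightarrow> 'c::real_normed_vector"
  assumes add: "\<And>x y. \<lbrakk>x \<in> carrier A; y \<in> carrier A\<rbrakk> \<Longrightarrow> F (x \<oplus> y) = F x + F y"
    and bound: "\<And>x. x \<in> carrier A \<Longrightarrow> norm (F x) \<le> K * cnorm A x"
  shows "closedin (norm_topology A) {x \<in> carrier A. F x = 0}"
proof -
  interpret M: Metric_space "carrier A" "cdist A" by (rule Metric_space_cdist)
  show ?thesis
    unfolding norm_topology_def M.closedin_metric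
  proof (intro conjI allI impI)
    fix x assume "x \<in> carrier A - {x \<in> carrier A. F x = 0}"
    then have x: "x \<in> carrier A" "F x \<noteq> 0" by auto
    \<comment> \<open>A positive constant in place of \<open>K\<close> allows dividing by
      it.\<close>
    define L where "L = max K 1"
    have L: "L > 0" "norm (F y) \<le> L * cnorm A y" if "y \<in> carrier A" for y
      using bound[OF that] mult_right_mono[OF _ cnorm_nonneg[OF that], of K L] by (auto simp: L_def)
    have "F y \<noteq> 0" if y: "y \<in> carrier A" "cdist A x y < norm (F x) / L" for y
    proof
      assume "F y = 0"
      have "F x = F (x \<ominus> y) + F y"
      proof -
        have "x = (x \<ominus> y) \<oplus> y" using x y by algebra
        then show ?thesis using add[of "x \<ominus> y" y] x y by simp
      qed
      with \<open>F y = 0\<close> have "norm (F x) \<le> L * cdist A x y"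
        using L(2)[of "x \<ominus> y"] x y by (simp add: cdist_def)
      with y(2) L(1)[OF y(1)] show False by (simp add: field_simps)
    qed
    then show "\<exists>r>0. disjnt {x \<in> carrier A. F x = 0} (M.mball x r)"
      using x L(1)[OF x(1)] by (intro exI[of _ "norm (F x) / L"]) (auto simp: disjnt_iff)
  qed auto
qed

section \<open>Hermitian elements and square roots\<close>

definition herm :: "'a set" where
  "herm = {x \<in> carrier A. star A x = x}"

lemma hermI: "\<lbrakk>x \<in> carrier A; star A x = x\<rbrakk> \<Longrightarrow> x \<in> herm"
  and herm_carrier [simp]: "x \<in> herm \<Longrightarrow> x \<in> carrier A"
  and herm_star [simp]: "x \<in> herm \<Longrightarrow> star A x = x"
  by (simp_all add: herm_def)

lemma herm_zero [simp]: "\<zero> \<in> herm" and herm_one [simp]: "\<one> \<in> herm"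
  by (auto intro: hermI)

lemma herm_add [simp]: "\<lbrakk>x \<in> herm; y \<in> herm\<rbrakk> \<Longrightarrow> x \<oplus> y \<in> herm"
  by (rule hermI) (simp_all add: star_add)

lemma herm_minus [simp]: "x \<in> herm \<Longrightarrow> \<ominus> x \<in> herm"
  by (rule hermI) (simp_all add: star_minus)

lemma herm_diff [simp]: "\<lbrakk>x \<in> herm; y \<in> herm\<rbrakk> \<Longrightarrow> x \<ominus> y \<in> herm"
  by (rule hermI) (simp_all add: star_diff)

lemma herm_smult [simp]: "x \<in> herm \<Longrightarrow> complex_of_real c \<odot> x \<in> herm"
  by (rule hermI) (simp_all add: star_smult)

lemma herm_square: "x \<in> carrier A \<Longrightarrow> star A x \<otimes> x \<in> herm"
  by (rule hermI) (simp_all add: star_mult star_star)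

text \<open>The element \<open>\<one> - y\<close> is the fixed point of the contraction \<open>z \<mapsto> (h + z\<^sup>2) / 2\<close>.\<close>

lemma sqrt_one_minus:
  assumes h: "h \<in> herm" and small: "cnorm A h \<le> 1/2"
  shows "\<exists>y\<in>herm. y \<otimes> y = \<one> \<ominus> h"
proof -
  interpret M: Metric_space "carrier A" "cdist A" by (rule Metric_space_cdist)
  define g where "g z = (1/2) \<odot> (h \<oplus> z \<otimes> z)" for z
  define z where "z n = (g ^^ n) \<zero>" for n
  have z_Suc: "z (Suc n) = g (z n)" for n by (simp add: z_def)
  have half: "complex_of_real (1/2) = 1/2" by simp
  \<comment> \<open>The ball of radius 1/2 is invariant, as (1/2 + 1/4) / 2 < 1/2.\<close>
  have z: "z n \<in> herm \<and> cnorm A (z n) \<le> 1/2" for n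
  proof (induction n)
    case 0 show ?case by (simp add: z_def)
  next
    case (Suc n)
    then have zz: "z n \<otimes> z n \<in> herm" using herm_square[of "z n"] by simp
    have "cnorm A (z n \<otimes> z n) \<le> 1/2 * (1/2)"
      using Suc cnorm_mult[of "z n" "z n"] mult_mono[of "cnorm A (z n)" "1/2" "cnorm A (z n)" "1/2"]
        cnorm_nonneg[of "z n"] by simp
    then have "cnorm A (h \<oplus> z n \<otimes> z n) \<le> 1"
      using cnorm_triangle[of h "z n \<otimes> z n"] h zz small by simp
    then have "cnorm A (z (Suc n)) \<le> 1/2"
      using h zz Suc by (simp add: z_Suc g_def cnorm_smult)
    moreover have "z (Suc n) \<in> herm"
      using herm_smult[of "h \<oplus> z n \<otimes> z n" "1/2"] h zz by (simp add: z_Suc g_def)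
    ultimately show ?case by simp
  qed
  \<comment> \<open>The identity x x - y y = x (x - y) + (x - y) y needs no commutativity. On the
    ball of radius 1/2 the resulting factor is at most 1/2.\<close>
  have gdiff: "cnorm A (g x \<ominus> g y) \<le> (cnorm A x + cnorm A y) / 2 * cnorm A (x \<ominus> y)"
    if "x \<in> carrier A" "y \<in> carrier A" for x y
  proof -
    have hc: "h \<in> carrier A" using h by simp
    have "g x \<ominus> g y = (1/2) \<odot> ((h \<oplus> x \<otimes> x) \<ominus> (h \<oplus> y \<otimes> y))"
      using that hc by (simp add: g_def smult_diff_right)
    also have "(h \<oplus> x \<otimes> x) \<ominus> (h \<oplus> y \<otimes> y) = x \<otimes> (x \<ominus> y) \<oplus> (x \<ominus> y) \<otimes> y"
      using that hc by algebra
    finally have "cnorm A (g x \<ominus> g y) = 1/2 * cnorm A (x \<otimes> (x \<ominus> y) \<oplus> (x \<ominus> y) \<otimes> y)"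
      using that by (simp add: cnorm_smult)
    also have "\<dots> \<le> 1/2 * (cnorm A x * cnorm A (x \<ominus> y) + cnorm A (x \<ominus> y) * cnorm A y)"
      using that cnorm_triangle[of "x \<otimes> (x \<ominus> y)" "(x \<ominus> y) \<otimes> y"]
        cnorm_mult[of x "x \<ominus> y"] cnorm_mult[of "x \<ominus> y" y] by simp
    finally show ?thesis by (simp add: algebra_simps)
  qed
  have zc: "z n \<in> carrier A" for n using z by simp
  have step: "cnorm A (z (Suc n) \<ominus> z n) \<le> (1/2)^n" for n
  proof (induction n)
    case 0
    have "z (Suc 0) \<ominus> \<zero> = z (Suc 0)" using herm_carrier[of "z (Suc 0)"] z by algebra
    then show ?case using z[of "Suc 0"] by (simp add: z_def)
  next
    case (Suc n)
    have "cnorm A (z (Suc (Suc n)) \<ominus> z (Suc n))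
        \<le> (cnorm A (z (Suc n)) + cnorm A (z n)) / 2 * cnorm A (z (Suc n) \<ominus> z n)"
      using gdiff[OF zc zc, of "Suc n" n] by (simp only: z_Suc)
    also have "\<dots> \<le> 1/2 * (1/2)^n"
      using Suc z[of n] z[of "Suc n"] by (intro mult_mono) (simp_all add: cnorm_nonneg)
    finally show ?case by simp
  qed
  \<comment> \<open>The bound is the geometric sum of the steps from n to n + k - 1.\<close>
  have dist: "cnorm A (z (n + k) \<ominus> z n) \<le> 2 * (1/2)^n * (1 - (1/2)^k)" for n k
  proof (induction k)
    case 0 show ?case using z[of n] by (simp add: r_neg a_minus_def)
  next
    case (Suc k)
    have "cnorm A (z (n + Suc k) \<ominus> z n)
        \<le> cnorm A (z (Suc (n + k)) \<ominus> z (n + k)) + cnorm A (z (n + k) \<ominus> z n)"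
      using cnorm_diff_triangle z by simp
    also have "\<dots> \<le> (1/2)^(n+k) + 2 * (1/2)^n * (1 - (1/2)^k)"
      using step[of "n + k"] Suc by linarith
    finally show ?case by (simp add: power_add algebra_simps)
  qed
  have "M.MCauchy z"
    unfolding M.MCauchy_def
  proof (intro conjI allI impI)
    fix e :: real assume "e > 0"
    then obtain N where N: "(1/2::real)^N < e / 2"
      using real_arch_pow_inv[of "e / 2" "1/2"] by auto
    have *: "cdist A (z (n + k)) (z n) < e" if "N \<le> n" for n k
    proof -
      have "cdist A (z (n + k)) (z n) \<le> 2 * (1/2)^n * (1 - (1/2)^k)"
        using dist z by (simp add: cdist_def)
      also have "\<dots> \<le> 2 * (1/2)^n" by (simp add: mult_left_le)
      also have "\<dots> \<le> 2 * (1/2)^N" using that by (simp add: power_decreasing)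
      finally show ?thesis using N by simp
    qed
    then have "cdist A (z n) (z n') < e" if "N \<le> n" "N \<le> n'" for n n'
      using that *[of n' "n - n'"] *[of n "n' - n"] M.commute[of "z n" "z n'"] z
      by (cases "n \<le> n'") (auto simp: not_le)
    then show "\<exists>N. \<forall>n n'. N \<le> n \<longrightarrow> N \<le> n' \<longrightarrow> cdist A (z n) (z n') < e"
      by blast
  qed (use z in auto)
  then obtain l where "limitin M.mtopology z l sequentially"
    using complete unfolding M.mcomplete_def by blast
  then have l: "l \<in> carrier A" and lim: "\<And>e. e > 0 \<Longrightarrow> \<exists>N. \<forall>n\<ge>N. cdist A (z n) l < e"
    unfolding M.limit_metric_sequentially by blast+
  define d where "d n = cnorm A (z n \<ominus> l)" for n
  have "d \<longlonglongrightarrow> 0"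
    unfolding LIMSEQ_iff using lim l z by (auto simp: d_def cdist_def cnorm_nonneg)
  \<comment> \<open>Equations for the limit follow from estimates whose right-hand side tends to 0;
    this form covers both \<open>star A l = l\<close> and \<open>g l = l\<close>.\<close>
  have zero: "x = y" if "x \<in> carrier A" "y \<in> carrier A"
    "\<And>n. cnorm A (x \<ominus> y) \<le> K * d n + d (Suc n)" for x y K
  proof -
    have "(\<lambda>n. K * d n + d (Suc n)) \<longlonglongrightarrow> K * 0 + 0"
      using \<open>d \<longlonglongrightarrow> 0\<close> by (intro tendsto_intros LIMSEQ_Suc)
    then have "cnorm A (x \<ominus> y) \<le> 0"
      using that(3) by (intro LIMSEQ_le_const[of _ 0]) auto
    then show ?thesis
      using that cnorm_nonneg[of "x \<ominus> y"] cnorm_eq_zero[of "x \<ominus> y"] diff_eq_zero_iff[of x y]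
      by simp
  qed
  have "star A l = l"
  proof (rule zero[of _ _ 2])
    fix n
    have "cnorm A (star A l \<ominus> z n) = d n"
      using cnorm_star[of "l \<ominus> z n"] l z cnorm_diff_commute[of l "z n"]
      by (simp add: star_diff d_def)
    then have "cnorm A (star A l \<ominus> l) \<le> d n + d n"
      using cnorm_diff_triangle[of "star A l" "z n" l] l z by (simp add: d_def)
    then show "cnorm A (star A l \<ominus> l) \<le> 2 * d n + d (Suc n)"
      using cnorm_nonneg[of "z (Suc n) \<ominus> l"] l z by (simp add: d_def)
  qed (use l in auto)
  have "g l = l"
  proof (rule zero[of _ _ "(cnorm A l + 1/2) / 2"])
    fix n
    have "cnorm A (g l \<ominus> l) \<le> cnorm A (g l \<ominus> g (z n)) + d (Suc n)"
      using cnorm_diff_triangle[of "g l" "g (z n)" l] l z h by (simp add: d_def z_Suc g_def)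
    moreover have "cnorm A (g l \<ominus> g (z n)) \<le> (cnorm A l + 1/2) / 2 * d n"
    proof -
      have "cnorm A (g l \<ominus> g (z n)) \<le> (cnorm A l + cnorm A (z n)) / 2 * d n"
        using gdiff[OF l zc, of n] cnorm_diff_commute[OF l zc, of n] by (simp add: d_def)
      also have "\<dots> \<le> (cnorm A l + 1/2) / 2 * d n"
        using z[of n] l zc by (intro mult_right_mono) (simp_all add: d_def cnorm_nonneg)
      finally show ?thesis .
    qed
    ultimately show "cnorm A (g l \<ominus> l) \<le> (cnorm A l + 1/2) / 2 * d n + d (Suc n)" by linarith
  qed (use l h in \<open>simp_all add: g_def\<close>)
  \<comment> \<open>The fixed point equation 2 l = h + l l says that the square of 1 - l is 1 -
    h.\<close>
  then have ll: "l \<oplus> l = h \<oplus> l \<otimes> l"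
    using smult_half_double[of "h \<oplus> l \<otimes> l"] l h by (simp add: g_def)
  have "(\<one> \<ominus> l) \<otimes> (\<one> \<ominus> l) = \<one> \<ominus> (l \<oplus> l \<otimes> \<one>) \<oplus> l \<otimes> l"
    using l by algebra
  also have "\<dots> = \<one> \<ominus> (l \<oplus> l) \<oplus> l \<otimes> l"
    using l by simp
  also have "\<dots> = \<one> \<ominus> h"
    unfolding ll using l herm_carrier[OF h] by algebra
  finally show ?thesis
    using \<open>star A l = l\<close> l by (intro bexI[of _ "\<one> \<ominus> l"]) (auto intro!: hermI simp: star_diff)
qed

text \<open>A stand-in for the positive elements that requires no spectral theory: sums, conjugates
  and nonnegative multiples stay inside by algebra alone.\<close>

inductive_set sos :: "'a set" where
  sos_zero: "\<zero> \<in> sos"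
| sos_step: "\<lbrakk>x \<in> sos; y \<in> carrier A\<rbrakk> \<Longrightarrow> x \<oplus> star A y \<otimes> y \<in> sos"

lemma sos_herm: "x \<in> sos \<Longrightarrow> x \<in> herm"
  by (induction rule: sos.induct) (simp_all add: herm_square)

lemma sos_carrier [simp]: "x \<in> sos \<Longrightarrow> x \<in> carrier A"
  by (simp add: sos_herm)

lemma sos_square: "y \<in> carrier A \<Longrightarrow> star A y \<otimes> y \<in> sos"
  using sos_step[OF sos_zero, of y] by simp

lemma sos_one: "\<one> \<in> sos"
  using sos_square[of \<one>] by simp

lemma sos_add:
  assumes "x \<in> sos" "y \<in> sos"
  shows "x \<oplus> y \<in> sos"
  using assms(2)
proof (induction rule: sos.induct)
  case (sos_step u v)
  then have "x \<oplus> (u \<oplus> star A v \<otimes> v) = (x \<oplus> u) \<oplus> star A v \<otimes> v"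
    using assms by (simp add: a_assoc)
  with sos_step show ?case by (simp add: sos.sos_step)
qed (use assms in simp)

text \<open>Each summand stays a square, since z* (v* v) z is the product of v z with its
  adjoint.\<close>

lemma sos_conjugate:
  assumes x: "x \<in> sos" and z: "z \<in> carrier A"
  shows "star A z \<otimes> x \<otimes> z \<in> sos"
  using x
proof (induction rule: sos.induct)
  case sos_zero
  then show ?case using z sos.sos_zero by simp
next
  case (sos_step u v)
  have "star A z \<otimes> (u \<oplus> star A v \<otimes> v) \<otimes> z = star A z \<otimes> u \<otimes> z \<oplus> star A (v \<otimes> z) \<otimes> (v \<otimes> z)"
  proof -
    have "star A z \<otimes> (u \<oplus> star A v \<otimes> v) \<otimes> z
        = star A z \<otimes> u \<otimes> z \<oplus> (star A z \<otimes> star A v) \<otimes> (v \<otimes> z)"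
      using sos_step z star_closed[of v] star_closed[of z] sos_carrier[of u] by algebra
    then show ?thesis using sos_step z by (simp add: star_mult)
  qed
  with sos_step z show ?case by (simp add: sos.sos_step)
qed

lemma sos_smult:
  assumes "x \<in> sos" "c \<ge> 0"
  shows "complex_of_real c \<odot> x \<in> sos"
proof -
  \<comment> \<open>Conjugation by the square root of a scalar is multiplication by the
    scalar.\<close>
  let ?s = "complex_of_real (sqrt c) \<odot> \<one>"
  have "star A ?s \<otimes> x \<otimes> ?s = (complex_of_real (sqrt c) * complex_of_real (sqrt c)) \<odot> x"
    using assms by (simp add: star_smult smult_mult_left smult_mult_right smult_assoc)
  also have "complex_of_real (sqrt c) * complex_of_real (sqrt c) = complex_of_real c"
    using assms(2) by (simp flip: of_real_mult)
  finally show ?thesis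
    using sos_conjugate[OF assms(1), of ?s] by simp
qed

text \<open>Multiples of the unit dominate every Hermitian element. The factor 2 comes from
  \<open>sqrt_one_minus\<close>: c - x is c times 1 - x / c, and x / c must have norm at most
  1/2.\<close>

lemma sos_order_unit:
  assumes x: "x \<in> herm" and c: "c > 0" "2 * cnorm A x \<le> c"
  shows "complex_of_real c \<odot> \<one> \<ominus> x \<in> sos"
proof -
  let ?h = "complex_of_real (1 / c) \<odot> x"
  have "cnorm A ?h \<le> 1/2"
    using x c by (simp add: cnorm_smult norm_divide field_simps)
  then obtain y where y: "y \<in> herm" "y \<otimes> y = \<one> \<ominus> ?h"
    using sqrt_one_minus[of ?h] herm_smult[OF x] by blast
  have "complex_of_real c \<odot> (y \<otimes> y) \<in> sos"
    using sos_smult[of "y \<otimes> y" c] sos_square[of y] y(1) c by simp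
  also have "complex_of_real c \<odot> (y \<otimes> y) = complex_of_real c \<odot> \<one> \<ominus> complex_of_real c \<odot> ?h"
    unfolding y(2) using x by (simp add: smult_diff_right)
  also have "complex_of_real c \<odot> ?h = x"
    using x c smult_assoc[of x "complex_of_real c" "complex_of_real (1 / c)"] by (simp add: smult_one)
  finally show ?thesis .
qed

section \<open>Cones of Hermitian elements and the functionals they define\<close>

definition pos_cone :: "'a set \<Rightarrow> bool" where
  "pos_cone C \<longleftrightarrow> C \<subseteq> herm \<and> sos \<subseteq> C \<and> (\<forall>x\<in>C. \<forall>y\<in>C. x \<oplus> y \<in> C) \<and>
     (\<forall>x\<in>C. \<forall>c\<ge>0. complex_of_real c \<odot> x \<in> C)"

text \<open>Zorn's lemma applies because avoiding -1 passes to unions of chains. If neither x nor -x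
  were in a maximal cone, adjoining x would have to produce -1 = m + t x with t > 0, and then -x =
  (m + 1) / t would be in the cone after all.\<close>

lemma maximal_pos_cone:
  assumes "pos_cone C" "\<ominus> \<one> \<notin> C"
  obtains M where "C \<subseteq> M" "pos_cone M" "\<ominus> \<one> \<notin> M" "\<And>x. x \<in> herm \<Longrightarrow> x \<in> M \<or> \<ominus> x \<in> M"
proof -
  let ?\<A> = "{M. C \<subseteq> M \<and> pos_cone M \<and> \<ominus> \<one> \<notin> M}"
  have "\<exists>M\<in>?\<A>. \<forall>X\<in>?\<A>. M \<subseteq> X \<longrightarrow> X = M"
  proof (rule subset_Zorn_nonempty)
    fix \<C> assume ne: "\<C> \<noteq> {}" and ch: "subset.chain ?\<A> \<C>"
    have in_A: "\<And>X. X \<in> \<C> \<Longrightarrow> X \<in> ?\<A>"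
      using ch unfolding subset.chain_def by blast
    have "x \<oplus> y \<in> \<Union>\<C>" if "x \<in> \<Union>\<C>" "y \<in> \<Union>\<C>" for x y
    proof -
      obtain X where "X \<in> \<C>" "x \<in> X" "y \<in> X"
        using \<open>x \<in> \<Union>\<C>\<close> \<open>y \<in> \<Union>\<C>\<close> ch unfolding subset.chain_def by blast
      then show ?thesis
        using in_A[of X] unfolding pos_cone_def by blast
    qed
    moreover have "complex_of_real c \<odot> x \<in> \<Union>\<C>" if "x \<in> \<Union>\<C>" "c \<ge> 0" for x c
    proof -
      obtain X where "X \<in> \<C>" "x \<in> X" using \<open>x \<in> \<Union>\<C>\<close> by blast
      then show ?thesis
        using in_A[of X] \<open>c \<ge> 0\<close> unfolding pos_cone_def by blast
    qed
    moreover have "\<Union>\<C> \<subseteq> herm" using in_A unfolding pos_cone_def by blast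
    moreover have "sos \<subseteq> \<Union>\<C>" "C \<subseteq> \<Union>\<C>" using ne in_A unfolding pos_cone_def by blast+
    moreover have "\<ominus> \<one> \<notin> \<Union>\<C>" using in_A by blast
    ultimately show "\<Union>\<C> \<in> ?\<A>"
      unfolding pos_cone_def by simp
  qed (use assms in auto)
  then obtain M where MA: "M \<in> ?\<A>" and maxA: "\<forall>X\<in>?\<A>. M \<subseteq> X \<longrightarrow> X = M"
    by (rule bexE)
  have M: "C \<subseteq> M" "pos_cone M" "\<ominus> \<one> \<notin> M"
    using MA by simp_all
  have max: "X = M" if "C \<subseteq> X" "pos_cone X" "\<ominus> \<one> \<notin> X" "M \<subseteq> X" for X
    using maxA that by simp
  have MD: "M \<subseteq> herm" "sos \<subseteq> M" "\<And>x y. \<lbrakk>x \<in> M; y \<in> M\<rbrakk> \<Longrightarrow> x \<oplus> y \<in> M"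
      "\<And>x c. \<lbrakk>x \<in> M; c \<ge> 0\<rbrakk> \<Longrightarrow> complex_of_real c \<odot> x \<in> M"
    using M(2) unfolding pos_cone_def by blast+
  have "x \<in> M \<or> \<ominus> x \<in> M" if x: "x \<in> herm" for x
  proof (rule disjCI)
    assume nx: "\<ominus> x \<notin> M"
    define X where "X = {m \<oplus> complex_of_real t \<odot> x | m t. m \<in> M \<and> t \<ge> 0}"
    have X: "m \<oplus> complex_of_real t \<odot> x \<in> X" if "m \<in> M" "t \<ge> 0" for m t
      unfolding X_def using that by blast
    have M_X: "M \<subseteq> X"
    proof
      fix m assume "m \<in> M"
      then have "m = m \<oplus> complex_of_real 0 \<odot> x" using MD(1) x by auto
      then show "m \<in> X" using X[OF \<open>m \<in> M\<close>, of 0] by simp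
    qed
    have x_X: "x \<in> X"
    proof -
      have "x = \<zero> \<oplus> complex_of_real 1 \<odot> x" "\<zero> \<in> M"
        using x smult_one MD(2) sos_zero by auto
      then show ?thesis using X[of \<zero> 1] by simp
    qed
    have "pos_cone X"
      unfolding pos_cone_def
    proof (intro conjI ballI allI impI)
      show "X \<subseteq> herm" unfolding X_def using MD(1) x by auto
      show "sos \<subseteq> X" using MD(2) M_X by blast
    next
      fix a b assume "a \<in> X" "b \<in> X"
      then obtain m n s t where *: "m \<in> M" "n \<in> M" "s \<ge> 0" "t \<ge> 0"
          "a = m \<oplus> complex_of_real s \<odot> x" "b = n \<oplus> complex_of_real t \<odot> x"
        unfolding X_def by blast
      have "m \<in> carrier A" "n \<in> carrier A" "complex_of_real s \<odot> x \<in> carrier A"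
          "complex_of_real t \<odot> x \<in> carrier A"
        using * MD(1) x by auto
      then have "a \<oplus> b = (m \<oplus> n) \<oplus> (complex_of_real s \<odot> x \<oplus> complex_of_real t \<odot> x)"
        unfolding * by algebra
      then have "a \<oplus> b = (m \<oplus> n) \<oplus> complex_of_real (s + t) \<odot> x"
        using x by (simp add: smult_l_distr)
      then show "a \<oplus> b \<in> X"
        using X[OF MD(3)[of m n], of "s + t"] *(1-4) by simp
    next
      fix a and c :: real assume "a \<in> X" "c \<ge> 0"
      then obtain m s where *: "m \<in> M" "s \<ge> 0" "a = m \<oplus> complex_of_real s \<odot> x"
        unfolding X_def by blast
      then have "complex_of_real c \<odot> a = complex_of_real c \<odot> m \<oplus> complex_of_real (c * s) \<odot> x"
        using MD(1) x by (auto simp: smult_r_distr smult_assoc)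
      then show "complex_of_real c \<odot> a \<in> X"
        using X[OF MD(4)[of m c], of "c * s"] *(1,2) \<open>c \<ge> 0\<close> by simp
    qed
    have "\<ominus> \<one> \<notin> X"
    proof
      assume "\<ominus> \<one> \<in> X"
      then obtain m t where m: "m \<in> M" "t \<ge> 0" "\<ominus> \<one> = m \<oplus> complex_of_real t \<odot> x"
        unfolding X_def by blast
      show False
      proof (cases "t = 0")
        case True
        then show False using m M(3) MD(1) x by auto
      next
        case False
        have mc: "m \<in> carrier A" "complex_of_real t \<odot> x \<in> carrier A" using m(1) MD(1) x by auto
        have "\<ominus> (complex_of_real t \<odot> x) = m \<oplus> (\<ominus> (m \<oplus> complex_of_real t \<odot> x))"
          using mc by algebra
        also have "\<dots> = m \<oplus> \<one>" by (simp flip: m(3))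
        finally have "\<ominus> (complex_of_real t \<odot> x) \<in> M"
          using MD(2,3) m(1) sos_one by auto
        then have "complex_of_real (1 / t) \<odot> (\<ominus> (complex_of_real t \<odot> x)) \<in> M"
          by (rule MD(4)) (use m(2) in simp)
        also have "complex_of_real (1 / t) \<odot> (\<ominus> (complex_of_real t \<odot> x))
            = \<ominus> ((complex_of_real (1 / t) * complex_of_real t) \<odot> x)"
          using x smult_assoc[OF herm_carrier[OF x]] smult_minus_right[of "complex_of_real t \<odot> x"]
          by (metis herm_carrier smult_closed)
        also have "\<dots> = \<ominus> x"
          using False x by (simp add: smult_one)
        finally show False using nx by simp
      qed
    qed
    then have "X = M"
      using max M(1) M_X \<open>pos_cone X\<close> by blast
    then show "x \<in> M" using x_X by simp
  qed
  with M that show thesis by blast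
qed

text \<open>The value at x is the supremum of the real multiples of 1 lying below x in the order of
  the cone. Totality makes lower and upper cuts meet, so that the supremum is linear; this replaces
  a Hahn-Banach argument.\<close>

lemma real_functional_of_total_cone:
  assumes M: "pos_cone M" "\<ominus> \<one> \<notin> M" and total: "\<And>x. x \<in> herm \<Longrightarrow> x \<in> M \<or> \<ominus> x \<in> M"
  obtains \<phi> :: "'a \<Rightarrow> real"
  where "\<And>x y. \<lbrakk>x \<in> herm; y \<in> herm\<rbrakk> \<Longrightarrow> \<phi> (x \<oplus> y) = \<phi> x + \<phi> y"
    and "\<And>c x. x \<in> herm \<Longrightarrow> \<phi> (complex_of_real c \<odot> x) = c * \<phi> x"
    and "\<phi> \<one> = 1" and "\<And>x. x \<in> M \<Longrightarrow> \<phi> x \<ge> 0"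
proof -
  have MD: "M \<subseteq> herm" "sos \<subseteq> M" "\<And>x y. \<lbrakk>x \<in> M; y \<in> M\<rbrakk> \<Longrightarrow> x \<oplus> y \<in> M"
      "\<And>x c. \<lbrakk>x \<in> M; c \<ge> 0\<rbrakk> \<Longrightarrow> complex_of_real c \<odot> x \<in> M"
    using M(1) unfolding pos_cone_def by blast+
  define e where "e c = complex_of_real c \<odot> \<one>" for c
  have e: "e c \<in> herm" "e c \<in> carrier A" for c by (simp_all add: e_def)
  have e_add: "e (a + b) = e a \<oplus> e b" for a b by (simp add: e_def smult_l_distr)
  have e_minus: "e (- a) = \<ominus> e a" for a by (simp add: e_def smult_minus_left)
  have e_mult: "complex_of_real a \<odot> e b = e (a * b)" for a b by (simp add: e_def smult_assoc)
  have e_pos: "e c \<in> M" if "c \<ge> 0" for c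
    using MD(2,4) sos_one that by (auto simp: e_def)
  have e_neg: "e c \<notin> M" if "c < 0" for c
  proof
    assume "e c \<in> M"
    then have "complex_of_real (1 / - c) \<odot> e c \<in> M" using MD(4)[of "e c" "1 / - c"] that by simp
    then have "e (- 1) \<in> M" unfolding e_mult using that by simp
    then show False using M(2) by (simp add: e_minus) (simp add: e_def smult_one)
  qed
  define L where "L x = {c. x \<ominus> e c \<in> M}" for x
  define \<phi> where "\<phi> x = Sup (L x)" for x
  have down: "b \<in> L x" if "a \<in> L x" "b \<le> a" "x \<in> herm" for a b x
  proof -
    have "e (a - b) \<in> M" using e_pos that by simp
    then have "(x \<ominus> e a) \<oplus> e (a - b) \<in> M" using MD(3) that by (simp add: L_def)
    also have "(x \<ominus> e a) \<oplus> e (a - b) = x \<ominus> e b"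
      using e[of a] e[of b] herm_carrier[OF that(3)] unfolding diff_conv_add_uminus e_add e_minus
      by algebra
    finally show ?thesis by (simp add: L_def)
  qed
  have add: "a + b \<in> L (x \<oplus> y)" if "a \<in> L x" "b \<in> L y" "x \<in> herm" "y \<in> herm" for a b x y
  proof -
    have "(x \<ominus> e a) \<oplus> (y \<ominus> e b) \<in> M" using MD(3) that by (simp add: L_def)
    also have "(x \<ominus> e a) \<oplus> (y \<ominus> e b) = (x \<oplus> y) \<ominus> e (a + b)"
      using e[of a] e[of b] herm_carrier[OF that(3)] herm_carrier[OF that(4)] unfolding e_add
      by algebra
    finally show ?thesis by (simp add: L_def)
  qed
  \<comment> \<open>Totality enters here: a real number that is not a lower bound of x is an upper
    bound.\<close>
  have neg: "- a \<in> L (\<ominus> x)" if "a \<notin> L x" "x \<in> herm" for a x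
  proof -
    have "\<ominus> (x \<ominus> e a) \<in> M" using total[of "x \<ominus> e a"] that e by (simp add: L_def)
    also have "\<ominus> (x \<ominus> e a) = \<ominus> x \<ominus> e (- a)"
      using e[of a] herm_carrier[OF that(2)] unfolding e_minus by algebra
    finally show ?thesis by (simp add: L_def)
  qed
  have scale: "c * a \<in> L (complex_of_real c \<odot> x)" if "a \<in> L x" "x \<in> herm" "c \<ge> 0" for a c x
    using MD(4)[of "x \<ominus> e a" c] that e by (simp add: L_def smult_diff_right e_mult)
  have L_zero: "a \<le> 0" if "a \<in> L \<zero>" for a
  proof (rule ccontr)
    assume "\<not> a \<le> 0"
    then have "e (- a) \<notin> M" using e_neg by simp
    moreover have "\<zero> \<ominus> e a = e (- a)" using e[of a] unfolding e_minus by algebra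
    ultimately show False using that by (simp add: L_def)
  qed
  have opp: "a + b \<le> 0" if "a \<in> L x" "b \<in> L (\<ominus> x)" "x \<in> herm" for a b x
  proof -
    have "a + b \<in> L (x \<oplus> (\<ominus> x))" using add[OF that(1,2)] that(3) by simp
    then show ?thesis using L_zero that(3) by (simp add: r_neg)
  qed
  \<comment> \<open>The order unit makes every cut nonempty; applied to -x it also bounds the cut of
    x from above.\<close>
  have ne: "- c \<in> L x" if "x \<in> herm" "c > 0" "2 * cnorm A x \<le> c" for x c
  proof -
    have "e c \<ominus> (\<ominus> x) \<in> sos"
      using sos_order_unit[of "\<ominus> x" c] that by (simp add: cnorm_minus e_def)
    moreover have "e c \<ominus> (\<ominus> x) = x \<ominus> e (- c)"
      using e[of c] herm_carrier[OF that(1)] unfolding e_minus by algebra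
    ultimately show ?thesis using MD(2) by (auto simp: L_def)
  qed
  have L_ne: "L x \<noteq> {}" if "x \<in> herm" for x
    using ne[OF that, of "2 * cnorm A x + 1"] cnorm_nonneg[of x] that by auto
  have L_bdd: "bdd_above (L x)" if "x \<in> herm" for x
  proof -
    obtain b where b: "b \<in> L (\<ominus> x)" using L_ne[OF herm_minus[OF \<open>x \<in> herm\<close>]] by blast
    have "a \<le> - b" if "a \<in> L x" for a using opp[OF that b \<open>x \<in> herm\<close>] by simp
    then show ?thesis by (auto simp: bdd_above_def)
  qed
  have \<phi>_ge: "a \<le> \<phi> x" if "a \<in> L x" "x \<in> herm" for a x
    unfolding \<phi>_def using that L_bdd by (simp add: cSup_upper)
  have \<phi>_le: "\<phi> x \<le> b" if "\<And>a. a \<in> L x \<Longrightarrow> a \<le> b" "x \<in> herm" for b x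
    unfolding \<phi>_def using that L_ne by (simp add: cSup_least)
  have \<phi>_minus: "\<phi> (\<ominus> x) = - \<phi> x" if x: "x \<in> herm" for x
  proof (rule antisym)
    have "b \<le> - \<phi> x" if b: "b \<in> L (\<ominus> x)" for b
    proof -
      have "a \<le> - b" if "a \<in> L x" for a using opp[OF that b x] by simp
      then have "\<phi> x \<le> - b" using \<phi>_le x by blast
      then show ?thesis by simp
    qed
    then show "\<phi> (\<ominus> x) \<le> - \<phi> x" using \<phi>_le[OF _ herm_minus[OF x]] by blast
    show "- \<phi> x \<le> \<phi> (\<ominus> x)"
    proof (rule field_le_epsilon)
      fix d :: real assume "d > 0"
      then have "\<phi> x + d \<notin> L x" using \<phi>_ge[of "\<phi> x + d" x] x by auto
      then have "- (\<phi> x + d) \<in> L (\<ominus> x)" using neg x by blast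
      then show "- \<phi> x \<le> \<phi> (\<ominus> x) + d" using \<phi>_ge[of "- (\<phi> x + d)" "\<ominus> x"] x by simp
    qed
  qed
  \<comment> \<open>Suprema of lower cuts are at first only superadditive; the reverse inequality is
    the same statement for -x and -y, since \<phi> is odd.\<close>
  have super: "\<phi> x + \<phi> y \<le> \<phi> (x \<oplus> y)" if x: "x \<in> herm" and y: "y \<in> herm" for x y
  proof -
    have "\<phi> x \<le> \<phi> (x \<oplus> y) - \<phi> y"
    proof (rule \<phi>_le[OF _ x])
      fix a assume a: "a \<in> L x"
      have "\<phi> y \<le> \<phi> (x \<oplus> y) - a"
        using \<phi>_ge[OF add[OF a _ x y]] x y by (intro \<phi>_le) (auto simp: algebra_simps)
      then show "a \<le> \<phi> (x \<oplus> y) - \<phi> y" by simp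
    qed
    then show ?thesis by simp
  qed
  have \<phi>_add: "\<phi> (x \<oplus> y) = \<phi> x + \<phi> y" if x: "x \<in> herm" and y: "y \<in> herm" for x y
  proof -
    have "\<phi> (\<ominus> x) + \<phi> (\<ominus> y) \<le> \<phi> (\<ominus> (x \<oplus> y))"
      using super[of "\<ominus> x" "\<ominus> y"] x y by (simp add: minus_add)
    then show ?thesis using super[OF x y] x y by (simp add: \<phi>_minus)
  qed
  have scale_le: "c * \<phi> x \<le> \<phi> (complex_of_real c \<odot> x)" if x: "x \<in> herm" and c: "c > 0" for c x
  proof -
    have "\<phi> x \<le> \<phi> (complex_of_real c \<odot> x) / c"
      using \<phi>_ge[OF scale[OF _ x]] x c by (intro \<phi>_le) (auto simp: field_simps)
    then show ?thesis using c by (simp add: field_simps)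
  qed
  have scale_pos: "\<phi> (complex_of_real c \<odot> x) = c * \<phi> x" if x: "x \<in> herm" and c: "c > 0" for c x
  proof (rule antisym)
    have "1 / c * \<phi> (complex_of_real c \<odot> x) \<le> \<phi> (complex_of_real (1 / c) \<odot> (complex_of_real c \<odot> x))"
      using x c by (intro scale_le) auto
    also have "complex_of_real (1 / c) \<odot> (complex_of_real c \<odot> x) = x"
      using smult_assoc[of x "complex_of_real (1 / c)" "complex_of_real c"] x c by (simp add: smult_one)
    finally show "\<phi> (complex_of_real c \<odot> x) \<le> c * \<phi> x" using c by (simp add: field_simps)
  qed (rule scale_le[OF that])
  have \<phi>_zero: "\<phi> \<zero> = 0" using \<phi>_add[of \<zero> \<zero>] by simp
  have \<phi>_scale: "\<phi> (complex_of_real c \<odot> x) = c * \<phi> x" if x: "x \<in> herm" for c x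
  proof (cases c "0 :: real" rule: linorder_cases)
    case less
    have "complex_of_real c \<odot> x = \<ominus> (complex_of_real (- c) \<odot> x)"
      using x smult_minus_left[of x "complex_of_real (- c)"] by simp
    then show ?thesis using scale_pos[OF x, of "- c"] less x by (simp only: \<phi>_minus herm_smult)
  qed (use x \<phi>_zero scale_pos in simp_all)
  have "\<phi> \<one> = 1"
  proof (rule antisym)
    have "a \<le> 1" if "a \<in> L \<one>" for a
    proof -
      have "e (a - 1) = e a \<oplus> \<ominus> \<one>"
        unfolding diff_conv_add_uminus e_add e_minus by (simp add: e_def smult_one)
      moreover have "\<one> \<ominus> e a = \<zero> \<ominus> (e a \<oplus> \<ominus> \<one>)"
        using e[of a] by algebra
      ultimately have "\<one> \<ominus> e a = \<zero> \<ominus> e (a - 1)" by simp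
      then have "a - 1 \<in> L \<zero>" using that by (simp add: L_def)
      then show ?thesis using L_zero by fastforce
    qed
    then show "\<phi> \<one> \<le> 1" by (intro \<phi>_le) auto
    have "\<one> \<ominus> e 1 = \<zero>" by (simp add: e_def smult_one r_neg a_minus_def)
    then have "1 \<in> L \<one>" using MD(2) sos_zero by (auto simp: L_def)
    then show "1 \<le> \<phi> \<one>" using \<phi>_ge by simp
  qed
  moreover have "\<phi> x \<ge> 0" if "x \<in> M" for x
  proof -
    have x: "x \<in> herm" using that MD(1) by blast
    have "x \<ominus> e 0 = x" using x by (simp add: e_def a_minus_def)
    then have "0 \<in> L x" using that by (simp add: L_def)
    then show ?thesis using \<phi>_ge x by blast
  qed
  ultimately show thesis
    using that[of \<phi>] \<phi>_add \<phi>_scale by blast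
qed

text \<open>The constant 4 is 2 for the real and 2 for the imaginary part, each 2 coming from
  \<open>sos_order_unit\<close>. The optimal constant is 1, but any bound yields the continuity that
  is wanted.\<close>

definition state :: "('a \<Rightarrow> complex) \<Rightarrow> bool" where
  "state \<phi> \<longleftrightarrow>
     (\<forall>x\<in>carrier A. \<forall>y\<in>carrier A. \<phi> (x \<oplus> y) = \<phi> x + \<phi> y) \<and>
     (\<forall>c. \<forall>x\<in>carrier A. \<phi> (c \<odot> x) = c * \<phi> x) \<and> \<phi> \<one> = 1 \<and>
     (\<forall>x\<in>carrier A. \<phi> (star A x) = cnj (\<phi> x)) \<and> (\<forall>x\<in>sos. 0 \<le> Re (\<phi> x)) \<and>
     (\<forall>x\<in>carrier A. cmod (\<phi> x) \<le> 4 * cnorm A x)"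

section \<open>Real and imaginary parts, and the existence of states\<close>

definition re_part :: "'a \<Rightarrow> 'a" where
  "re_part x = (1/2) \<odot> (x \<oplus> star A x)"

definition im_part :: "'a \<Rightarrow> 'a" where
  "im_part x = (- \<i>/2) \<odot> (x \<ominus> star A x)"

lemma re_part_herm: "x \<in> carrier A \<Longrightarrow> re_part x \<in> herm"
  unfolding re_part_def by (rule hermI) (simp_all add: star_smult star_add star_star a_comm)

lemma im_part_herm: "x \<in> carrier A \<Longrightarrow> im_part x \<in> herm"
  unfolding im_part_def
  by (rule hermI)
     (simp_all add: star_smult star_diff star_star minus_diff[symmetric, of x] smult_minus_right
        flip: smult_minus_left)

lemma re_part_add:
  assumes "x \<in> carrier A" "y \<in> carrier A"
  shows "re_part (x \<oplus> y) = re_part x \<oplus> re_part y"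
proof -
  have "(x \<oplus> y) \<oplus> (star A x \<oplus> star A y) = (x \<oplus> star A x) \<oplus> (y \<oplus> star A y)"
    using assms star_closed[of x] star_closed[of y] by algebra
  then show ?thesis using assms by (simp add: re_part_def star_add smult_r_distr[symmetric])
qed

lemma im_part_add:
  assumes "x \<in> carrier A" "y \<in> carrier A"
  shows "im_part (x \<oplus> y) = im_part x \<oplus> im_part y"
proof -
  have "(x \<oplus> y) \<ominus> (star A x \<oplus> star A y) = (x \<ominus> star A x) \<oplus> (y \<ominus> star A y)"
    using assms star_closed[of x] star_closed[of y] by algebra
  then show ?thesis using assms by (simp add: im_part_def star_add smult_r_distr[symmetric])
qed

lemma re_part_smult:
  "x \<in> carrier A \<Longrightarrow> re_part (complex_of_real c \<odot> x) = complex_of_real c \<odot> re_part x"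
  by (simp add: re_part_def star_smult smult_r_distr[symmetric] smult_assoc[symmetric] mult.commute)

lemma im_part_smult:
  "x \<in> carrier A \<Longrightarrow> im_part (complex_of_real c \<odot> x) = complex_of_real c \<odot> im_part x"
  by (simp add: im_part_def star_smult smult_diff_right[symmetric] smult_assoc[symmetric] mult.commute)

lemma re_part_smult_i: "x \<in> carrier A \<Longrightarrow> re_part (\<i> \<odot> x) = \<ominus> im_part x"
  by (simp add: re_part_def im_part_def star_smult smult_r_distr smult_diff_right
      smult_assoc[symmetric] smult_minus_left[symmetric] a_minus_def smult_minus_right minus_add)

lemma im_part_smult_i: "x \<in> carrier A \<Longrightarrow> im_part (\<i> \<odot> x) = re_part x"
  by (simp add: re_part_def im_part_def star_smult smult_r_distr smult_diff_right
      smult_assoc[symmetric] smult_minus_left[symmetric] a_minus_def smult_minus_right)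

lemma re_part_star: "x \<in> carrier A \<Longrightarrow> re_part (star A x) = re_part x"
  by (simp add: re_part_def star_star a_comm)

lemma im_part_star: "x \<in> carrier A \<Longrightarrow> im_part (star A x) = \<ominus> im_part x"
  by (simp add: im_part_def star_star minus_diff[symmetric, of x] smult_minus_right)

lemma re_part_of_herm: "x \<in> herm \<Longrightarrow> re_part x = x"
  by (simp add: re_part_def smult_r_distr smult_half_double)

lemma im_part_of_herm: "x \<in> herm \<Longrightarrow> im_part x = \<zero>"
  by (simp add: im_part_def diff_eq_zero_iff[THEN iffD2])

lemma cnorm_re_part: "x \<in> carrier A \<Longrightarrow> cnorm A (re_part x) \<le> cnorm A x"
  using cnorm_triangle[of x "star A x"] by (simp add: re_part_def cnorm_smult cnorm_star)

lemma cnorm_im_part: "x \<in> carrier A \<Longrightarrow> cnorm A (im_part x) \<le> cnorm A x"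
  using cnorm_triangle[of x "\<ominus> star A x"]
  by (simp add: im_part_def cnorm_smult cnorm_star cnorm_minus a_minus_def norm_divide)

lemma state_exists:
  assumes "pos_cone C" "\<ominus> \<one> \<notin> C"
  obtains \<phi> where "state \<phi>" "\<And>x. x \<in> C \<Longrightarrow> 0 \<le> Re (\<phi> x)"
proof -
  obtain M where M: "C \<subseteq> M" "pos_cone M" "\<ominus> \<one> \<notin> M" "\<And>x. x \<in> herm \<Longrightarrow> x \<in> M \<or> \<ominus> x \<in> M"
    using maximal_pos_cone[OF assms] by metis
  obtain f :: "'a \<Rightarrow> real"
    where f_add: "\<And>x y. \<lbrakk>x \<in> herm; y \<in> herm\<rbrakk> \<Longrightarrow> f (x \<oplus> y) = f x + f y"
      and f_scale: "\<And>c x. x \<in> herm \<Longrightarrow> f (complex_of_real c \<odot> x) = c * f x"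
      and f_one: "f \<one> = 1" and f_nonneg: "\<And>x. x \<in> M \<Longrightarrow> f x \<ge> 0"
    using real_functional_of_total_cone[OF M(2-4)] by metis
  have MD: "M \<subseteq> herm" "sos \<subseteq> M" using M(2) unfolding pos_cone_def by blast+
  have f_minus: "f (\<ominus> x) = - f x" if "x \<in> herm" for x
    using f_scale[OF that, of "- 1"] that by (simp add: smult_minus_one)
  \<comment> \<open>The slack \<open>d\<close> provides the strictly positive scalar that
    \<open>sos_order_unit\<close> demands even for x = 0.\<close>
  have f_le: "f x \<le> 2 * cnorm A x" if x: "x \<in> herm" for x
  proof (rule field_le_epsilon)
    fix d :: real assume "d > 0"
    define c where "c = 2 * cnorm A x + d"
    have "c > 0" using cnorm_nonneg[of x] x \<open>d > 0\<close> by (simp add: c_def)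
    then have "complex_of_real c \<odot> \<one> \<ominus> x \<in> M"
      using sos_order_unit[OF x, of c] MD(2) \<open>d > 0\<close> by (auto simp: c_def)
    then have "0 \<le> f (complex_of_real c \<odot> \<one> \<oplus> \<ominus> x)" using f_nonneg by (simp add: a_minus_def)
    also have "\<dots> = c - f x" using x by (simp add: f_add f_scale f_one f_minus)
    finally show "f x \<le> 2 * cnorm A x + d" by (simp add: c_def)
  qed
  have f_abs: "\<bar>f x\<bar> \<le> 2 * cnorm A x" if x: "x \<in> herm" for x
    using f_le[OF x] f_le[OF herm_minus[OF x]] x by (simp add: f_minus cnorm_minus)
  define \<phi> where "\<phi> x = Complex (f (re_part x)) (f (im_part x))" for x
  have f_zero: "f \<zero> = 0" using f_add[of \<zero> \<zero>] by simp
  have add: "\<phi> (x \<oplus> y) = \<phi> x + \<phi> y" if "x \<in> carrier A" "y \<in> carrier A" for x y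
    using that by (simp add: \<phi>_def re_part_add im_part_add f_add re_part_herm im_part_herm complex_eq_iff)
  have scale: "\<phi> (complex_of_real c \<odot> x) = complex_of_real c * \<phi> x" if "x \<in> carrier A" for c x
    using that by (simp add: \<phi>_def re_part_smult im_part_smult f_scale re_part_herm im_part_herm complex_eq_iff)
  have scale_i: "\<phi> (\<i> \<odot> x) = \<i> * \<phi> x" if "x \<in> carrier A" for x
    using that by (simp add: \<phi>_def re_part_smult_i im_part_smult_i f_minus im_part_herm complex_eq_iff)
  \<comment> \<open>Real homogeneity and homogeneity for the imaginary unit together give all
    complex scalars.\<close>
  have "\<phi> (c \<odot> x) = c * \<phi> x" if x: "x \<in> carrier A" for c x
  proof -
    have "c \<odot> x = (complex_of_real (Re c) + \<i> * complex_of_real (Im c)) \<odot> x"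
      by (simp flip: complex_eq)
    also have "\<dots> = complex_of_real (Re c) \<odot> x \<oplus> \<i> \<odot> (complex_of_real (Im c) \<odot> x)"
      using x by (simp only: smult_l_distr smult_assoc)
    also have "\<phi> \<dots> = (complex_of_real (Re c) + \<i> * complex_of_real (Im c)) * \<phi> x"
      using x by (simp add: add scale scale_i algebra_simps)
    finally show ?thesis by (simp flip: complex_eq)
  qed
  moreover have "\<phi> x = complex_of_real (f x)" if "x \<in> herm" for x
    using that by (simp add: \<phi>_def re_part_of_herm im_part_of_herm f_zero complex_eq_iff)
  moreover have "\<phi> (star A x) = cnj (\<phi> x)" if "x \<in> carrier A" for x
    using that by (simp add: \<phi>_def re_part_star im_part_star f_minus im_part_herm complex_eq_iff)
  moreover have "cmod (\<phi> x) \<le> 4 * cnorm A x" if x: "x \<in> carrier A" for x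
    using cmod_le[of "\<phi> x"] f_abs[OF re_part_herm[OF x]] f_abs[OF im_part_herm[OF x]]
      cnorm_re_part[OF x] cnorm_im_part[OF x] by (simp add: \<phi>_def)
  ultimately have "state \<phi>" "\<And>x. x \<in> C \<Longrightarrow> 0 \<le> Re (\<phi> x)"
    using add f_one f_nonneg MD M(1) unfolding state_def by (auto simp: subset_iff)
  then show thesis by (rule that)
qed

section \<open>Positive matrices over the algebra\<close>

lemma finsum_lessThan_2:
  assumes "f 0 \<in> carrier A" "f 1 \<in> carrier A"
  shows "(\<Oplus>k\<in>{..<2::nat}. f k) = f 0 \<oplus> f 1"
proof -
  have "(\<Oplus>k\<in>{..<Suc (Suc 0)}. f k) = f (Suc 0) \<oplus> (f 0 \<oplus> (\<Oplus>k\<in>{..<0}. f k))"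
    using assms finsum_lessThan_Suc[of f "Suc 0"] finsum_lessThan_Suc[of f 0]
    by (auto simp: less_Suc_eq)
  then show ?thesis using assms by (simp add: numeral_2_eq_2 a_comm)
qed

text \<open>A Schur complement. If (a, b) and (c, d) are the columns of \<open>Y\<close> and w is
  \<open>X 0 1\<close>, then (c, d) - (a, b) w is the part of the second column orthogonal to the
  first, and its square is \<open>X 1 1\<close> minus w* w.\<close>

lemma mat_positive_2:
  assumes X: "mat_positive A 2 X" and one: "X 0 0 = \<one>"
  shows "X 1 0 = star A (X 0 1)" "X 1 1 \<ominus> star A (X 0 1) \<otimes> X 0 1 \<in> sos"
proof -
  obtain Y :: "nat \<Rightarrow> nat \<Rightarrow> 'a" where Y: "\<And>i j. \<lbrakk>i < 2; j < 2\<rbrakk> \<Longrightarrow> Y i j \<in> carrier A"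
    and XY: "\<And>i j. \<lbrakk>i < 2; j < 2\<rbrakk> \<Longrightarrow> X i j = (\<Oplus>k\<in>{..<2}. star A (Y k i) \<otimes> Y k j)"
    using X unfolding mat_positive_def by blast
  define a b c d where "a = Y 0 0" "b = Y 1 0" "c = Y 0 1" "d = Y 1 1"
  have cl: "a \<in> carrier A" "b \<in> carrier A" "c \<in> carrier A" "d \<in> carrier A"
    using Y by (simp_all add: a_b_c_d_def)
  have "X i j = star A (Y 0 i) \<otimes> Y 0 j \<oplus> star A (Y 1 i) \<otimes> Y 1 j" if "i < 2" "j < 2" for i j
    using XY[OF that] finsum_lessThan_2[of "\<lambda>k. star A (Y k i) \<otimes> Y k j"] Y that by simp
  then have Xs: "X 0 0 = star A a \<otimes> a \<oplus> star A b \<otimes> b" "X 0 1 = star A a \<otimes> c \<oplus> star A b \<otimes> d"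
    "X 1 0 = star A c \<otimes> a \<oplus> star A d \<otimes> b" "X 1 1 = star A c \<otimes> c \<oplus> star A d \<otimes> d"
    by (simp_all add: a_b_c_d_def)
  show X10: "X 1 0 = star A (X 0 1)"
    unfolding Xs using cl by (simp add: star_add star_mult star_star)
  define w where "w = X 0 1"
  define w' where "w' = star A w"
  have w: "w \<in> carrier A" "w' \<in> carrier A" unfolding w_def w'_def Xs using cl by simp_all
  have sq: "star A (y \<ominus> x \<otimes> w) \<otimes> (y \<ominus> x \<otimes> w) =
      star A y \<otimes> y \<ominus> (star A y \<otimes> x) \<otimes> w \<ominus> w' \<otimes> (star A x \<otimes> y) \<oplus> w' \<otimes> (star A x \<otimes> x) \<otimes> w"
    if x: "x \<in> carrier A" and y: "y \<in> carrier A" for x y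
  proof -
    have "star A (y \<ominus> x \<otimes> w) = star A y \<ominus> w' \<otimes> star A x"
      using x y w by (simp add: star_diff star_mult w'_def)
    then show ?thesis
      using x y w star_closed[OF x] star_closed[OF y] by (simp only:) algebra
  qed
  have "star A (c \<ominus> a \<otimes> w) \<otimes> (c \<ominus> a \<otimes> w) \<oplus> star A (d \<ominus> b \<otimes> w) \<otimes> (d \<ominus> b \<otimes> w)
      = X 1 1 \<ominus> X 1 0 \<otimes> w \<ominus> w' \<otimes> X 0 1 \<oplus> w' \<otimes> X 0 0 \<otimes> w"
    unfolding sq[OF cl(1,3)] sq[OF cl(2,4)] Xs
    using w cl star_closed[OF cl(1)] star_closed[OF cl(2)] star_closed[OF cl(3)] star_closed[OF cl(4)]
    by algebra
  also have "\<dots> = X 1 1 \<ominus> w' \<otimes> w \<ominus> w' \<otimes> w \<oplus> w' \<otimes> w"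
    unfolding one X10 w_def[symmetric] w'_def[symmetric] using w by simp
  also have "\<dots> = X 1 1 \<ominus> w' \<otimes> w"
  proof -
    have "X 1 1 \<in> carrier A" unfolding Xs using cl by simp
    then show ?thesis using w by algebra
  qed
  finally show "X 1 1 \<ominus> star A (X 0 1) \<otimes> X 0 1 \<in> sos"
    using sos_add[OF sos_square[of "c \<ominus> a \<otimes> w"] sos_square[of "d \<ominus> b \<otimes> w"]] w cl
    by (simp add: w_def w'_def)
qed

lemma sos_as_finsum:
  assumes "x \<in> sos"
  shows "\<exists>(n::nat) y. (\<forall>k. y k \<in> carrier A) \<and> x = (\<Oplus>k\<in>{..<n}. star A (y k) \<otimes> y k)"
  using assms
proof (induction rule: sos.induct)
  case sos_zero
  show ?case by (intro exI[of _ 0] exI[of _ "\<lambda>_. \<zero>"]) simp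
next
  case (sos_step x z)
  then obtain n :: nat and y where y: "\<And>k. y k \<in> carrier A" "x = (\<Oplus>k\<in>{..<n}. star A (y k) \<otimes> y k)"
    by blast
  have "(\<Oplus>k\<in>{..<Suc n}. star A ((y(n := z)) k) \<otimes> (y(n := z)) k)
      = star A z \<otimes> z \<oplus> (\<Oplus>k\<in>{..<n}. star A ((y(n := z)) k) \<otimes> (y(n := z)) k)"
    using y(1) sos_step(2) by (subst finsum_lessThan_Suc) auto
  also have "(\<Oplus>k\<in>{..<n}. star A ((y(n := z)) k) \<otimes> (y(n := z)) k) = x"
    unfolding y(2) using y(1) by (intro finsum_cong') auto
  finally have "x \<oplus> star A z \<otimes> z = (\<Oplus>k\<in>{..<Suc n}. star A ((y(n := z)) k) \<otimes> (y(n := z)) k)"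
    using sos_step by (simp add: a_comm)
  moreover have "\<forall>k. (y(n := z)) k \<in> carrier A" using y(1) sos_step(2) by simp
  ultimately show ?case by blast
qed

text \<open>Padding with zeros leaves room for any number of squares in the Gram matrix, so there is no need
  to know that a sum of squares in a \<open>C\<^sup>*\<close>-algebra is itself a square.\<close>

lemma mat_positive_sos_padded:
  assumes k: "k \<in> sos" and a: "a \<in> carrier A" and b: "b \<in> carrier A"
    and X: "X 0 0 = k \<oplus> star A a \<otimes> a" "X 0 1 = star A a \<otimes> b" "X 1 0 = star A b \<otimes> a" "X 1 1 = star A b \<otimes> b"
    and X0: "\<And>i j. i \<ge> 2 \<or> j \<ge> 2 \<Longrightarrow> X i j = \<zero>"
  obtains n where "n \<ge> 2" "mat_positive A n X"
proof -
  obtain m :: nat and y where y: "\<And>i. y i \<in> carrier A" "k = (\<Oplus>i\<in>{..<m}. star A (y i) \<otimes> y i)"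
    using sos_as_finsum[OF k] by blast
  \<comment> \<open>The first \<open>m\<close> rows put the squares of \<open>k\<close> into the
    corner, row \<open>m\<close> is (a, b), and row \<open>Suc m\<close> vanishes: it guarantees
    size at least 2 when \<open>k\<close> is an empty sum.\<close>
  define Y :: "nat \<Rightarrow> nat \<Rightarrow> 'a" where
    "Y r i = (if r < m then (if i = 0 then y r else \<zero>)
       else if r = m then (if i = 0 then a else if i = 1 then b else \<zero>) else \<zero>)" for r i
  have Yc: "Y r i \<in> carrier A" for r i using y(1) a b by (simp add: Y_def)
  have eq: "X i j = (\<Oplus>r\<in>{..<Suc (Suc m)}. star A (Y r i) \<otimes> Y r j)" for i j
  proof -
    have "(\<Oplus>r\<in>{..<m}. star A (Y r i) \<otimes> Y r j) = (if i = 0 \<and> j = 0 then k else \<zero>)"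
    proof (cases "i = 0 \<and> j = 0")
      case True
      then show ?thesis unfolding y(2) using y(1) by (simp) (intro finsum_cong', auto simp: Y_def)
    next
      case False
      then have "(\<Oplus>r\<in>{..<m}. star A (Y r i) \<otimes> Y r j) = (\<Oplus>r\<in>{..<m}. \<zero>)"
        using y(1) by (intro finsum_cong') (auto simp: Y_def)
      then show ?thesis using False by (auto simp: finsum_zero)
    qed
    moreover have "(\<Oplus>r\<in>{..<Suc (Suc m)}. star A (Y r i) \<otimes> Y r j)
        = star A (Y m i) \<otimes> Y m j \<oplus> (\<Oplus>r\<in>{..<m}. star A (Y r i) \<otimes> Y r j)"
    proof -
      have "star A (Y (Suc m) i) \<otimes> Y (Suc m) j = \<zero>" by (simp add: Y_def)
      then show ?thesis using Yc by (subst finsum_lessThan_Suc; (subst finsum_lessThan_Suc)?) auto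
    qed
    moreover have "X i j = star A (Y m i) \<otimes> Y m j \<oplus> (if i = 0 \<and> j = 0 then k else \<zero>)"
    proof -
      consider "i \<ge> 2 \<or> j \<ge> 2" | "i = 0" "j = 0" | "i = 0" "j = 1" | "i = 1" "j = 0" | "i = 1" "j = 1"
        by linarith
      then show ?thesis
      proof cases
        case 1 then show ?thesis using X0[OF 1] a b by (auto simp: Y_def)
      qed (use X a b k in \<open>simp_all add: Y_def a_comm\<close>)
    qed
    ultimately show ?thesis by simp
  qed
  have "mat_positive A (Suc (Suc m)) X"
    unfolding mat_positive_def using eq Yc by blast
  then show thesis by (intro that[of "Suc (Suc m)"]) auto
qed

subsection \<open>The compression of a \<open>C\<^sup>*\<close>-algebra to two GNS vectors\<close>

context
  fixes \<phi> :: "'a \<Rightarrow> complex"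
  assumes state: "state \<phi>"
begin

lemma state_add: "\<lbrakk>x \<in> carrier A; y \<in> carrier A\<rbrakk> \<Longrightarrow> \<phi> (x \<oplus> y) = \<phi> x + \<phi> y"
  and state_smult: "x \<in> carrier A \<Longrightarrow> \<phi> (c \<odot> x) = c * \<phi> x"
  and state_one: "\<phi> \<one> = 1"
  and state_star: "x \<in> carrier A \<Longrightarrow> \<phi> (star A x) = cnj (\<phi> x)"
  and state_sos: "x \<in> sos \<Longrightarrow> 0 \<le> Re (\<phi> x)"
  and state_bound: "x \<in> carrier A \<Longrightarrow> cmod (\<phi> x) \<le> 4 * cnorm A x"
  using state by (simp_all add: state_def)

lemma state_diff: "\<lbrakk>x \<in> carrier A; y \<in> carrier A\<rbrakk> \<Longrightarrow> \<phi> (x \<ominus> y) = \<phi> x - \<phi> y"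
  using state_add[of x "\<ominus> y"] state_smult[of y "- 1"] by (simp add: a_minus_def smult_minus_one)

lemma state_herm: "x \<in> herm \<Longrightarrow> \<phi> x = complex_of_real (Re (\<phi> x))"
  using state_star[of x] by (simp add: complex_eq_iff)

text \<open>A degenerate Cauchy-Schwarz inequality: what kills the cyclic vector pairs to 0 with
  everything. For such \<open>n\<close> the form at x* + c n has no quadratic term in
  \<open>c\<close>, so a nonzero linear term would make it negative somewhere.\<close>

lemma state_null:
  assumes n: "n \<in> carrier A" "\<phi> (star A n \<otimes> n) = 0" and x: "x \<in> carrier A"
  shows "\<phi> (x \<otimes> n) = 0"
proof (rule ccontr)
  assume a: "\<phi> (x \<otimes> n) \<noteq> 0"
  define a where "a = \<phi> (x \<otimes> n)"
  \<comment> \<open>Chosen so that the real part of the form at \<open>?m\<close> becomes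
    -1.\<close>
  define t where "t = (Re (\<phi> (x \<otimes> star A x)) + 1) / (2 * (cmod a)\<^sup>2)"
  define c where "c = - (complex_of_real t * cnj a)"
  let ?m = "star A x \<oplus> c \<odot> n"
  have sx: "star A n \<otimes> star A x = star A (x \<otimes> n)" using n x by (simp add: star_mult)
  have "star A ?m \<otimes> ?m = (x \<oplus> cnj c \<odot> star A n) \<otimes> (star A x \<oplus> c \<odot> n)"
    using n x by (simp add: star_add star_smult star_star)
  also have "\<dots> = x \<otimes> star A x \<oplus> c \<odot> (x \<otimes> n) \<oplus>
      (cnj c \<odot> star A (x \<otimes> n) \<oplus> cnj c \<odot> (c \<odot> (star A n \<otimes> n)))"
    using n x by (simp add: l_distr r_distr smult_mult_left smult_mult_right sx smult_r_distr a_ac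
        mult.commute flip: smult_assoc)
  finally have "\<phi> (star A ?m \<otimes> ?m) = \<phi> (x \<otimes> star A x) + (c * a + cnj (c * a))"
    using n x by (simp add: state_add state_smult state_star a_def)
  then have "Re (\<phi> (star A ?m \<otimes> ?m)) = Re (\<phi> (x \<otimes> star A x)) + 2 * Re (c * a)"
    by simp
  also have "c * a = - complex_of_real (t * (cmod a)\<^sup>2)"
    using complex_norm_square[of a] by (simp add: c_def mult_ac)
  also have "t * (cmod a)\<^sup>2 = (Re (\<phi> (x \<otimes> star A x)) + 1) / 2"
    using a by (simp add: t_def a_def)
  finally have "Re (\<phi> (star A ?m \<otimes> ?m)) < 0" by simp
  moreover have "0 \<le> Re (\<phi> (star A ?m \<otimes> ?m))"
    using n x by (intro state_sos sos_square) auto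
  ultimately show False by simp
qed

context
  fixes v :: 'a
  assumes v: "v \<in> carrier A" and v_norm: "0 \<le> Re (\<phi> (star A v \<otimes> v \<ominus> \<one>))"
    and v_sos: "\<one> \<ominus> (star A v \<otimes> v \<oplus> v \<otimes> star A v) \<in> sos"
begin

text \<open>The state is at least 1 on v* v, at most 1 on v* v + v v*, and nonnegative on v
  v*.\<close>

lemma state_vv: "\<phi> (star A v \<otimes> v) = 1" "\<phi> (v \<otimes> star A v) = 0"
proof -
  have "0 \<le> Re (\<phi> (v \<otimes> star A v))"
    using state_sos[OF sos_square[of "star A v"]] v by (simp add: star_star)
  moreover have "Re (\<phi> (star A v \<otimes> v)) + Re (\<phi> (v \<otimes> star A v)) \<le> 1"
    using state_sos[OF v_sos] v by (simp add: state_diff state_add state_one)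
  moreover have "Re (\<phi> (star A v \<otimes> v)) \<ge> 1"
    using v_norm v by (simp add: state_diff state_one)
  ultimately have re: "Re (\<phi> (star A v \<otimes> v)) = 1" "Re (\<phi> (v \<otimes> star A v)) = 0" by linarith+
  show "\<phi> (star A v \<otimes> v) = 1" using state_herm[OF herm_square[OF v]] re by simp
  show "\<phi> (v \<otimes> star A v) = 0"
    using state_herm[OF herm_square[of "star A v"]] re v by (simp add: star_star)
qed

text \<open>In GNS terms, v* kills the cyclic vector.\<close>

lemma state_v_star: "x \<in> carrier A \<Longrightarrow> \<phi> (x \<otimes> star A v) = 0"
  using state_null[of "star A v" x] v state_vv by (simp add: star_star)

text \<open>In GNS terms, v v kills the cyclic vector and p = v* v fixes it. Conjugating the
  inequality \<open>v_sos\<close> by v bounds the sum of the values at v* v* v v and p p by 1, while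
  positivity on the square of 1 - p makes the value at p p at least 1.\<close>

lemma state_v_v: "x \<in> carrier A \<Longrightarrow> \<phi> (x \<otimes> (v \<otimes> v)) = 0"
  and state_v_star_v: "x \<in> carrier A \<Longrightarrow> \<phi> (x \<otimes> (star A v \<otimes> v)) = \<phi> x"
proof -
  define w where "w = star A v"
  define p where "p = w \<otimes> v"
  have w: "w \<in> carrier A" "star A w = v" and p: "p \<in> carrier A" "star A p = p"
    using v by (simp_all add: w_def p_def star_star star_mult)
  have "0 \<le> Re (\<phi> (w \<otimes> (\<one> \<ominus> (w \<otimes> v \<oplus> v \<otimes> w)) \<otimes> v))"
    using state_sos[OF sos_conjugate[OF v_sos v]] by (simp add: w_def)
  also have "w \<otimes> (\<one> \<ominus> (w \<otimes> v \<oplus> v \<otimes> w)) \<otimes> v = (w \<otimes> \<one>) \<otimes> v \<ominus> ((w \<otimes> w) \<otimes> (v \<otimes> v) \<oplus> p \<otimes> p)"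
    using w(1) v unfolding p_def by algebra
  also have "\<phi> \<dots> = 1 - (\<phi> ((w \<otimes> w) \<otimes> (v \<otimes> v)) + \<phi> (p \<otimes> p))"
    using w p v state_vv by (simp add: state_diff state_add w_def)
  finally have 1: "Re (\<phi> ((w \<otimes> w) \<otimes> (v \<otimes> v))) + Re (\<phi> (p \<otimes> p)) \<le> 1" by simp
  have "(\<one> \<ominus> p) \<otimes> (\<one> \<ominus> p) = \<one> \<ominus> (p \<oplus> p \<otimes> \<one>) \<oplus> p \<otimes> p"
    using p(1) by algebra
  then have q: "\<phi> (star A (\<one> \<ominus> p) \<otimes> (\<one> \<ominus> p)) = \<phi> (p \<otimes> p) - 1"
    using p state_vv by (simp add: star_diff state_diff state_add state_one) (simp add: p_def w_def)
  have 2: "Re (\<phi> (p \<otimes> p)) \<ge> 1"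
    using state_sos[OF sos_square[of "\<one> \<ominus> p"]] p q by simp
  have ww: "star A (v \<otimes> v) = w \<otimes> w" using v by (simp add: star_mult w_def)
  then have 3: "0 \<le> Re (\<phi> ((w \<otimes> w) \<otimes> (v \<otimes> v)))"
    using state_sos[OF sos_square[of "v \<otimes> v"]] v by simp
  have "Re (\<phi> ((w \<otimes> w) \<otimes> (v \<otimes> v))) = 0" "Re (\<phi> (p \<otimes> p)) = 1" using 1 2 3 by linarith+
  then have null: "\<phi> (star A (v \<otimes> v) \<otimes> (v \<otimes> v)) = 0" "\<phi> (star A (\<one> \<ominus> p) \<otimes> (\<one> \<ominus> p)) = 0"
    using state_herm[OF herm_square[of "v \<otimes> v"]] state_herm[OF herm_square[of p]] v p ww
    by (simp_all add: q)
  fix x assume x: "x \<in> carrier A"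
  show "\<phi> (x \<otimes> (v \<otimes> v)) = 0" using state_null[OF _ null(1) x] v by simp
  have "x \<otimes> (\<one> \<ominus> p) = x \<otimes> \<one> \<ominus> x \<otimes> p" using x p(1) by algebra
  then show "\<phi> (x \<otimes> (star A v \<otimes> v)) = \<phi> x"
    using state_null[OF _ null(2) x] x p by (simp add: state_diff) (simp add: p_def w_def)
qed

text \<open>In the GNS space of \<open>\<phi>\<close> with cyclic vector \<open>\<xi>\<close>, this is the matrix of \<open>x\<close> compressed to the
  orthonormal vectors \<open>v \<xi>, \<xi>\<close>.\<close>

definition compression :: "'a \<Rightarrow> complex^2^2" where
  "compression x = vector [vector [\<phi> (star A v \<otimes> x \<otimes> v), \<phi> (star A v \<otimes> x)], vector [\<phi> (x \<otimes> v), \<phi> x]]"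

lemma compression_nth [simp]:
  "compression x $1$1 = \<phi> (star A v \<otimes> x \<otimes> v)" "compression x $1$2 = \<phi> (star A v \<otimes> x)"
  "compression x $2$1 = \<phi> (x \<otimes> v)" "compression x $2$2 = \<phi> x"
  by (simp_all add: compression_def)

lemma compression_add:
  "\<lbrakk>x \<in> carrier A; y \<in> carrier A\<rbrakk> \<Longrightarrow> compression (x \<oplus> y) = compression x + compression y"
  using v by (simp add: matrix_eq_2 l_distr r_distr state_add)

lemma compression_smult:
  "x \<in> carrier A \<Longrightarrow> compression (c \<odot> x) = map_matrix ((*) c) (compression x)"
  using v by (simp add: matrix_eq_2 smult_mult_left smult_mult_right state_smult)

lemma compression_star:
  assumes "x \<in> carrier A"
  shows "compression (star A x) = ctranspose (compression x)"
proof -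
  have "star A v \<otimes> star A x \<otimes> v = star A (star A v \<otimes> x \<otimes> v)"
    "star A v \<otimes> star A x = star A (x \<otimes> v)" "star A x \<otimes> v = star A (star A v \<otimes> x)"
    using assms v by (simp_all add: star_mult star_star m_assoc)
  then show ?thesis
    using assms v by (simp add: matrix_eq_2 state_star)
qed

lemma compression_one: "compression \<one> = mat 1"
proof -
  have "\<phi> (star A v) = 0" using state_v_star[of \<one>] v by simp
  moreover from this have "\<phi> v = 0" using state_star[of v] v by simp
  ultimately show ?thesis using v state_vv by (simp add: matrix_eq_2 state_one)
qed

text \<open>The span of v \<xi> and \<xi> is invariant under v and v*, which act on it as
  \<open>E12\<close> and \<open>E21\<close>; hence such a factor on the right can be split
  off.\<close>

lemma compression_mult_v:
  assumes x: "x \<in> carrier A"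
  shows "compression (x \<otimes> v) = compression x ** E12"
    and "compression (x \<otimes> star A v) = compression x ** E21"
  using x v state_v_v[of x] state_v_v[of "star A v \<otimes> x"] state_v_star[of x]
    state_v_star[of "star A v \<otimes> x"] state_v_star_v[of x] state_v_star_v[of "star A v \<otimes> x"]
  by (simp_all add: matrix_eq_2 matrix_mult_2_nth m_assoc)

lemma compression_v: "compression v = E12" "compression (star A v) = E21"
  using compression_mult_v[of \<one>] v by (simp_all add: compression_one)

text \<open>Left factors become right factors under the adjoint.\<close>

lemma compression_v_mult:
  assumes x: "x \<in> carrier A"
  shows "compression (v \<otimes> x) = E12 ** compression x"
    and "compression (star A v \<otimes> x) = E21 ** compression x"
proof -
  have ct: "ctranspose E12 = E21" "ctranspose E21 = E12" by (simp_all add: matrix_eq_2)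
  have "compression (v \<otimes> x) = ctranspose (compression (star A x \<otimes> star A v))"
    "compression (star A v \<otimes> x) = ctranspose (compression (star A x \<otimes> v))"
    using x v by (simp_all add: star_mult star_star flip: compression_star)
  then show "compression (v \<otimes> x) = E12 ** compression x"
      "compression (star A v \<otimes> x) = E21 ** compression x"
    using x v by (simp_all add: compression_mult_v ctranspose_mult ct compression_star)
qed

section \<open>Continuity and multiplicative domain of the compression\<close>

lemma compression_bound: "\<exists>K\<ge>0. \<forall>x\<in>carrier A. norm (compression x) \<le> K * cnorm A x"
proof (intro exI conjI ballI)
  \<comment> \<open>A bound of |v| that is at least 1, so that V^2 dominates the powers 0, 1 and 2
    of |v| occurring in the entries.\<close>
  define V where "V = 1 + cnorm A v"
  have V: "V \<ge> 1" "cnorm A v \<le> V" using cnorm_nonneg[OF v] by (auto simp: V_def)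
  \<comment> \<open>16 is four entries times the constant 4 in \<open>state\<close>.\<close>
  show "0 \<le> 16 * V\<^sup>2" by simp
  fix x assume x: "x \<in> carrier A"
  have n: "cnorm A x \<ge> 0" by (rule cnorm_nonneg[OF x])
  have l: "cnorm A (star A v \<otimes> y) \<le> V * cnorm A y" "cnorm A (y \<otimes> v) \<le> V * cnorm A y"
    if "y \<in> carrier A" for y
    using cnorm_mult[of "star A v" y] cnorm_mult[of y v] v that V(2) cnorm_nonneg[OF that]
      mult_right_mono[of "cnorm A v" V "cnorm A y"] by (simp_all add: cnorm_star mult.commute)
  have V1: "cnorm A y \<le> V * cnorm A y" if "y \<in> carrier A" for y
    using V(1) cnorm_nonneg[OF that] mult_right_mono[of 1 V "cnorm A y"] by simp
  have e: "cnorm A (star A v \<otimes> x \<otimes> v) \<le> V\<^sup>2 * cnorm A x" "cnorm A (star A v \<otimes> x) \<le> V\<^sup>2 * cnorm A x"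
    "cnorm A (x \<otimes> v) \<le> V\<^sup>2 * cnorm A x" "cnorm A x \<le> V\<^sup>2 * cnorm A x"
  proof -
    have le: "a \<le> V\<^sup>2 * cnorm A x" if "a \<le> V * b" "b \<le> V * cnorm A x" for a b
    proof -
      have "V * b \<le> V * (V * cnorm A x)" using that(2) V(1) by (intro mult_left_mono) auto
      then show ?thesis using that(1) by (simp add: power2_eq_square mult.assoc)
    qed
    show "cnorm A (star A v \<otimes> x \<otimes> v) \<le> V\<^sup>2 * cnorm A x"
      by (rule le[OF l(2) l(1)[OF x]]) (use v x in simp)
    show "cnorm A (star A v \<otimes> x) \<le> V\<^sup>2 * cnorm A x" by (rule le[OF l(1)[OF x] V1[OF x]])
    show "cnorm A (x \<otimes> v) \<le> V\<^sup>2 * cnorm A x" by (rule le[OF l(2)[OF x] V1[OF x]])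
    show "cnorm A x \<le> V\<^sup>2 * cnorm A x" by (rule le[OF V1[OF x] V1[OF x]])
  qed
  have row: "norm a \<le> norm (a$1) + norm (a$2)" for a :: "'b::real_normed_vector^2"
    using L2_set_le_sum[of UNIV "\<lambda>i. norm (a$i)"] by (simp add: norm_vec_def sum_2)
  have "norm (compression x) \<le> (cmod (compression x $1$1) + cmod (compression x $1$2))
      + (cmod (compression x $2$1) + cmod (compression x $2$2))"
    using row[of "compression x"] row[of "compression x $ 1"] row[of "compression x $ 2"] by linarith
  also have "\<dots> \<le> 4 * (4 * (V\<^sup>2 * cnorm A x))"
    using e state_bound[of "star A v \<otimes> x \<otimes> v"] state_bound[of "star A v \<otimes> x"]
      state_bound[of "x \<otimes> v"] state_bound[of x] x v by simp
  finally show "norm (compression x) \<le> 16 * V\<^sup>2 * cnorm A x" by simp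
qed

text \<open>The multiplicative domain familiar from completely positive maps. It reduces
  multiplicativity on the whole algebra to the generators.\<close>

definition mult_domain :: "'a set" where
  "mult_domain = {b \<in> carrier A. \<forall>x\<in>carrier A.
     compression (x \<otimes> b) = compression x ** compression b \<and>
     compression (b \<otimes> x) = compression b ** compression x}"

text \<open>For each x the two defects of multiplicativity are bounded additive maps of b; the
  domain is the intersection of their kernels.\<close>

lemma closedin_mult_domain: "closedin (norm_topology A) mult_domain"
proof -
  obtain K where K: "K \<ge> 0" "\<And>x. x \<in> carrier A \<Longrightarrow> norm (compression x) \<le> K * cnorm A x"
    using compression_bound by blast
  have "closedin (norm_topology A) {b \<in> carrier A. compression (x \<otimes> b) - compression x ** compression b = 0}
      \<and> closedin (norm_topology A) {b \<in> carrier A. compression (b \<otimes> x) - compression b ** compression x = 0}"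
    if x: "x \<in> carrier A" for x
  proof -
    obtain C where C: "\<forall>B. norm (compression x ** B) \<le> C * norm B \<and> norm (B ** compression x) \<le> C * norm B"
      using norm_matrix_mult_le[of "compression x"] by (rule exE)
    have bound: "norm (compression y - Z) \<le> (K * cnorm A x + \<bar>C\<bar> * K) * cnorm A b"
      if "b \<in> carrier A" "y \<in> carrier A" "cnorm A y \<le> cnorm A x * cnorm A b" "norm Z \<le> C * norm (compression b)" for b y Z
    proof -
      have "norm (compression y) \<le> K * (cnorm A x * cnorm A b)"
        using K(2)[OF that(2)] mult_left_mono[OF that(3) K(1)] by linarith
      moreover have "C * norm (compression b) \<le> \<bar>C\<bar> * (K * cnorm A b)"
        using K(2)[OF that(1)] by (intro mult_mono) auto
      ultimately show ?thesis
        using norm_triangle_ineq4[of "compression y" Z] that(4) by (simp add: algebra_simps)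
    qed
    show ?thesis
    proof (intro conjI; rule closedin_kernel[where K = "K * cnorm A x + \<bar>C\<bar> * K"])
      fix b assume b: "b \<in> carrier A"
      show "norm (compression (x \<otimes> b) - compression x ** compression b) \<le> (K * cnorm A x + \<bar>C\<bar> * K) * cnorm A b"
        by (rule bound) (use b x C cnorm_mult[of x b] in auto)
      have "cnorm A (b \<otimes> x) \<le> cnorm A x * cnorm A b"
        using cnorm_mult[of b x] b x by (simp add: mult.commute)
      then show "norm (compression (b \<otimes> x) - compression b ** compression x) \<le> (K * cnorm A x + \<bar>C\<bar> * K) * cnorm A b"
        using b x C by (intro bound) auto
    qed (use x in \<open>simp_all add: l_distr r_distr compression_add matrix_add_ldistrib matrix_eq_2 matrix_mult_2_nth algebra_simps del: compression_nth\<close>)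
  qed
  then have "closedin (norm_topology A) (\<Inter>x\<in>carrier A.
      {b \<in> carrier A. compression (x \<otimes> b) - compression x ** compression b = 0} \<inter>
      {b \<in> carrier A. compression (b \<otimes> x) - compression b ** compression x = 0})"
    by (intro closedin_INT closedin_Int) (use one_closed in blast)+
  also have "(\<Inter>x\<in>carrier A.
      {b \<in> carrier A. compression (x \<otimes> b) - compression x ** compression b = 0} \<inter>
      {b \<in> carrier A. compression (b \<otimes> x) - compression b ** compression x = 0}) = mult_domain"
    using one_closed by (auto simp: mult_domain_def)
  finally show ?thesis .
qed

lemma cstar_subalgebra_mult_domain: "cstar_subalgebra A mult_domain"
  unfolding cstar_subalgebra_def closed_star_subspace_def
proof (intro conjI ballI allI)
  have zero: "compression \<zero> = 0"
    using compression_smult[of \<zero> 0] by (simp add: matrix_eq_2)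
  show "\<zero> \<in> mult_domain" by (simp add: mult_domain_def zero)
next
  fix x y assume "x \<in> mult_domain" "y \<in> mult_domain"
  then show "x \<oplus> y \<in> mult_domain"
    by (simp add: mult_domain_def l_distr r_distr compression_add matrix_add_ldistrib)
       (simp add: matrix_eq_2 matrix_mult_2_nth algebra_simps del: compression_nth)
next
  fix c x assume "x \<in> mult_domain"
  then show "c \<odot> x \<in> mult_domain"
    by (simp add: mult_domain_def smult_mult_left smult_mult_right compression_smult
        smult_matrix_mult_left smult_matrix_mult_right)
next
  fix b assume b: "b \<in> mult_domain"
  then have bc: "b \<in> carrier A" by (simp add: mult_domain_def)
  \<comment> \<open>The adjoint exchanges left and right products, which is why the domain is
    two-sided.\<close>
  have "compression (x \<otimes> star A b) = compression x ** compression (star A b) \<and>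
     compression (star A b \<otimes> x) = compression (star A b) ** compression x" if x: "x \<in> carrier A" for x
  proof -
    have "compression (x \<otimes> star A b) = ctranspose (compression (b \<otimes> star A x))"
      "compression (star A b \<otimes> x) = ctranspose (compression (star A x \<otimes> b))"
      using x bc by (simp_all add: star_mult star_star flip: compression_star)
    then show ?thesis
      using b x bc by (simp add: mult_domain_def ctranspose_mult compression_star)
  qed
  then show "star A b \<in> mult_domain" using bc by (simp add: mult_domain_def)
next
  fix x y assume "x \<in> mult_domain" "y \<in> mult_domain"
  then show "x \<otimes> y \<in> mult_domain"
    by (simp add: mult_domain_def m_assoc[symmetric])
       (simp add: m_assoc matrix_mul_assoc)
qed (rule closedin_mult_domain)

lemma star_hom_compression:
  assumes S: "cstar_generated A S = carrier A"
    and span: "\<And>s. s \<in> S \<Longrightarrow> \<exists>a b c. s = a \<odot> \<one> \<oplus> (b \<odot> v \<oplus> c \<odot> star A v)"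
  shows "star_hom A M2 compression"
proof -
  have D: "cstar_subalgebra A mult_domain" by (rule cstar_subalgebra_mult_domain)
  have "\<one> \<in> mult_domain" "v \<in> mult_domain" "star A v \<in> mult_domain"
    using v by (simp_all add: mult_domain_def compression_one compression_mult_v compression_v_mult compression_v)
  then have "S \<subseteq> mult_domain"
    using span D unfolding cstar_subalgebra_def closed_star_subspace_def by (metis subsetI)
  then have "carrier A \<subseteq> mult_domain"
    using D S unfolding cstar_generated_def by blast
  then show ?thesis
    by (auto simp: star_hom_def mult_domain_def compression_add compression_smult compression_star)
qed

end
end

end

section \<open>The \<open>C\<^sup>*\<close>-envelope of the Toeplitz matrices\<close>

lemma finsum_mat_algebra:
  fixes f :: "'i \<Rightarrow> complex^'n^'n"
  assumes "finite I"
  shows "finsum mat_algebra f I = sum f I"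
proof -
  interpret ring "mat_algebra :: (complex^'n^'n) cstar" by (rule ring_mat_algebra)
  show ?thesis using assms by (induction) (simp_all add: finsum_insert)
qed

lemma mat_positive_mat_algebra:
  "mat_positive (mat_algebra :: (complex^'n^'n) cstar) n X \<longleftrightarrow>
     (\<exists>Y :: nat \<Rightarrow> nat \<Rightarrow> complex^'n^'n. \<forall>i<n. \<forall>j<n. X i j = (\<Sum>k<n. ctranspose (Y k i) ** Y k j))"
  by (simp add: mat_positive_def finsum_mat_algebra)

text \<open>The left-hand side is the quadratic form of \<open>X\<close> at the vector \<open>(e\<^sub>2, - e\<^sub>1, 0, \<dots>)\<close>.\<close>

lemma mat_positive_M2_quadratic_form:
  fixes X :: "nat \<Rightarrow> nat \<Rightarrow> complex^2^2"
  assumes "mat_positive M2 n X" "n \<ge> 2"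
  shows "0 \<le> Re (X 0 0 $2$2 - X 0 1 $2$1 - X 1 0 $1$2 + X 1 1 $1$1)"
proof -
  obtain Y :: "nat \<Rightarrow> nat \<Rightarrow> complex^2^2"
    where Y: "\<And>i j. \<lbrakk>i < n; j < n\<rbrakk> \<Longrightarrow> X i j = (\<Sum>k<n. ctranspose (Y k i) ** Y k j)"
    using assms(1) unfolding mat_positive_mat_algebra by blast
  have "X 0 0 $2$2 - X 0 1 $2$1 - X 1 0 $1$2 + X 1 1 $1$1
      = (\<Sum>k<n. (ctranspose (Y k 0) ** Y k 0)$2$2 - (ctranspose (Y k 0) ** Y k 1)$2$1
          - (ctranspose (Y k 1) ** Y k 0)$1$2 + (ctranspose (Y k 1) ** Y k 1)$1$1)"
    using assms(2) by (simp add: Y sum_subtractf sum.distrib)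
  \<comment> \<open>For X = Y* Y the form is the sum over \<open>k\<close> of the squared lengths of
    the vectors Y k 0 e_2 - Y k 1 e_1.\<close>
  also have "\<dots> = (\<Sum>k<n. cnj (Y k 0 $1$2 - Y k 1 $1$1) * (Y k 0 $1$2 - Y k 1 $1$1)
      + cnj (Y k 0 $2$2 - Y k 1 $2$1) * (Y k 0 $2$2 - Y k 1 $2$1))"
    by (intro sum.cong) (simp_all add: matrix_mult_2_nth algebra_simps)
  finally have eq: "X 0 0 $2$2 - X 0 1 $2$1 - X 1 0 $1$2 + X 1 1 $1$1 = \<dots>" .
  have "0 \<le> Re (cnj z * z)" for z by simp
  then show ?thesis
    unfolding eq Re_sum plus_complex.sel by (intro sum_nonneg add_nonneg_nonneg)
qed

lemma mat_positive_M2_unitary: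
  assumes u: "ctranspose u ** u = mat 1"
    and X: "X 0 0 = mat 1" "X 0 1 = u" "X 1 0 = ctranspose u" "X 1 1 = mat 1"
  shows "mat_positive M2 2 X"
  unfolding mat_positive_mat_algebra
proof (intro exI allI impI)
  \<comment> \<open>Only the first row (1, u) of the factor is nonzero; its Gram matrix has rows (1,
    u), (u*, u* u).\<close>
  define Y where "Y k i = (if k = 0 then if i = 0 then mat 1 else u else 0 :: complex^2^2)" for k i :: nat
  have ct: "ctranspose (mat 1) = (mat 1 :: complex^2^2)" "ctranspose 0 = (0 :: complex^2^2)"
    by (simp_all add: matrix_eq_2)
  fix i j :: nat assume "i < 2" "j < 2"
  then have "i = 0 \<or> i = 1" "j = 0 \<or> j = 1" by auto
  moreover have "(\<Sum>k<2. ctranspose (Y k i) ** Y k j) = ctranspose (Y 0 i) ** Y 0 j"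
    by (simp add: numeral_2_eq_2 Y_def ct)
  ultimately show "X i j = (\<Sum>k<2. ctranspose (Y k i) ** Y k j)"
    using X u by (auto simp: Y_def ct)
qed

section \<open>The Toeplitz system, the algebra it generates and the universal property\<close>

lemma toeplitz2_decomp:
  assumes "t \<in> toeplitz2"
  shows "t = map_matrix ((*) (t$1$1)) (mat 1) + (map_matrix ((*) (t$1$2)) E12 + map_matrix ((*) (t$2$1)) E21)"
  using assms by (simp add: matrix_eq_2 toeplitz2_iff)

lemma toeplitz2_mem: "mat 1 \<in> toeplitz2" "E12 \<in> toeplitz2" "E21 \<in> toeplitz2" "0 \<in> toeplitz2"
    "s \<in> toeplitz2 \<Longrightarrow> t \<in> toeplitz2 \<Longrightarrow> s + t \<in> toeplitz2"
    "t \<in> toeplitz2 \<Longrightarrow> map_matrix ((*) c) t \<in> toeplitz2" "t \<in> toeplitz2 \<Longrightarrow> ctranspose t \<in> toeplitz2"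
  by (simp_all add: toeplitz2_iff)

lemma operator_system_toeplitz2: "operator_system M2 toeplitz2"
proof -
  have "closed {A :: complex^2^2. A$1$1 = A$2$2}"
    by (intro closed_Collect_eq continuous_intros)
  also have "{A :: complex^2^2. A$1$1 = A$2$2} = toeplitz2"
    by (auto simp: toeplitz2_iff)
  finally show ?thesis
    by (simp add: operator_system_def closed_star_subspace_def norm_topology_mat_algebra toeplitz2_mem)
qed

text \<open>The diagonal matrix units are the products of \<open>E12\<close> and \<open>E21\<close>;
  this gives both generation and the surjectivity of the homomorphism.\<close>

lemma matrix_units_decomp:
  "A = map_matrix ((*) (A$1$1)) (E12 ** E21) + (map_matrix ((*) (A$1$2)) E12 +
     (map_matrix ((*) (A$2$1)) E21 + map_matrix ((*) (A$2$2)) (E21 ** E12)))"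
  by (simp add: matrix_eq_2 matrix_mult_2_nth)

lemma cstar_generated_toeplitz2: "cstar_generated M2 toeplitz2 = UNIV"
proof -
  have "D = UNIV" if D: "cstar_subalgebra M2 D" "toeplitz2 \<subseteq> D" for D
  proof -
    have "E12 \<in> D" "E21 \<in> D" using D(2) toeplitz2_mem by auto
    then have "A \<in> D" for A
      using D(1) by (subst matrix_units_decomp) (simp add: cstar_subalgebra_def closed_star_subspace_def)
    then show ?thesis by auto
  qed
  then show ?thesis unfolding cstar_generated_def by blast
qed

lemma generating_embedding_toeplitz2: "generating_embedding M2 toeplitz2 M2 (\<lambda>x. x)"
  by (simp add: generating_embedding_def complete_order_embedding_def unital_cstar_algebra_mat_algebra
      cstar_generated_toeplitz2 image_def)

lemma toeplitz2_universal:
  fixes B :: "'b cstar"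
  assumes "generating_embedding M2 toeplitz2 B j"
  shows "\<exists>\<rho>. star_hom B M2 \<rho> \<and> \<rho> ` carrier B = UNIV \<and> (\<forall>x\<in>toeplitz2. \<rho> (j x) = x)"
proof -
  interpret B: unital_cstar_algebra B using assms by (simp add: generating_embedding_def)
  note T = toeplitz2_mem
  have j_closed: "\<And>x. x \<in> toeplitz2 \<Longrightarrow> j x \<in> carrier B"
    and j_add: "\<And>x y. \<lbrakk>x \<in> toeplitz2; y \<in> toeplitz2\<rbrakk> \<Longrightarrow> j (x + y) = j x \<oplus>\<^bsub>B\<^esub> j y"
    and j_smult: "\<And>c x. x \<in> toeplitz2 \<Longrightarrow> j (map_matrix ((*) c) x) = c \<odot>\<^bsub>B\<^esub> j x"
    and j_pos: "\<And>n X. (\<And>i j. \<lbrakk>i < n; j < n\<rbrakk> \<Longrightarrow> X i j \<in> toeplitz2) \<Longrightarrow>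
        mat_positive M2 n X \<longleftrightarrow> mat_positive B n (\<lambda>i k. j (X i k))"
    and j_one: "j (mat 1) = \<one>\<^bsub>B\<^esub>"
    and gen: "cstar_generated B (j ` toeplitz2) = carrier B"
    using assms by (auto simp: generating_embedding_def complete_order_embedding_def)
  have j_zero: "j 0 = \<zero>\<^bsub>B\<^esub>"
  proof -
    have "map_matrix ((*) 0) 0 = (0 :: complex^2^2)" by (simp add: matrix_eq_2)
    then show ?thesis using j_smult[OF T(4), of 0] j_closed[OF T(4)] by simp
  qed
  define v w where "v = j E12" and "w = j E21"
  have vw: "v \<in> carrier B" "w \<in> carrier B" using j_closed T by (simp_all add: v_def w_def)
  \<comment> \<open>The definition of the embedding does not say that \<open>j\<close> respects
    adjoints; for unitaries this is read off the off-diagonal entries of a positive matrix.\<close>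
  have unitary: "j (ctranspose u) = star B (j u) \<and> \<one>\<^bsub>B\<^esub> \<ominus>\<^bsub>B\<^esub> star B (j u) \<otimes>\<^bsub>B\<^esub> j u \<in> B.sos"
    if u: "u \<in> toeplitz2" "ctranspose u ** u = mat 1" for u
  proof -
    define X where "X i k = (if i = k then mat 1 else if i = (0::nat) then u else ctranspose u)" for i k :: nat
    have "mat_positive M2 2 X"
      by (rule mat_positive_M2_unitary[OF u(2)]) (simp_all add: X_def)
    then have "mat_positive B 2 (\<lambda>i k. j (X i k))"
      using j_pos[of 2 X] u(1) T by (simp add: X_def)
    from B.mat_positive_2[OF this] show ?thesis
      by (simp add: X_def j_one)
  qed
  \<comment> \<open>Images of two Toeplitz unitaries that span the off-diagonal matrices.\<close>
  define p q where "p = j (E12 + E21)" and "q = j (E12 + map_matrix ((*) (- 1)) E21)"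
  have p: "p = v \<oplus>\<^bsub>B\<^esub> w"
    by (simp add: p_def j_add T v_def w_def)
  have q: "q = v \<ominus>\<^bsub>B\<^esub> w"
    using vw by (simp add: q_def j_add j_smult T v_def w_def B.smult_minus_one a_minus_def)
  have "j (ctranspose (E12 + E21)) = star B p" "\<one>\<^bsub>B\<^esub> \<ominus>\<^bsub>B\<^esub> star B p \<otimes>\<^bsub>B\<^esub> p \<in> B.sos"
    "j (ctranspose (E12 + map_matrix ((*) (- 1)) E21)) = star B q" "\<one>\<^bsub>B\<^esub> \<ominus>\<^bsub>B\<^esub> star B q \<otimes>\<^bsub>B\<^esub> q \<in> B.sos"
    unfolding p_def q_def
    by (use unitary[of "E12 + E21"] unitary[of "E12 + map_matrix ((*) (- 1)) E21"]
        in \<open>simp_all add: T matrix_eq_2 matrix_mult_2_nth\<close>)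
  moreover have "ctranspose (E12 + E21) = E12 + E21"
    "ctranspose (E12 + map_matrix ((*) (- 1)) E21) = E21 + map_matrix ((*) (- 1)) E12"
    by (simp_all add: matrix_eq_2)
  moreover have "j (E21 + map_matrix ((*) (- 1)) E12) = w \<ominus>\<^bsub>B\<^esub> v"
    using vw by (simp add: j_add j_smult T v_def w_def B.smult_minus_one a_minus_def)
  ultimately have sp: "star B p = v \<oplus>\<^bsub>B\<^esub> w" and sq: "star B q = w \<ominus>\<^bsub>B\<^esub> v"
    and sos: "\<one>\<^bsub>B\<^esub> \<ominus>\<^bsub>B\<^esub> star B p \<otimes>\<^bsub>B\<^esub> p \<in> B.sos" "\<one>\<^bsub>B\<^esub> \<ominus>\<^bsub>B\<^esub> star B q \<otimes>\<^bsub>B\<^esub> q \<in> B.sos"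
    by (simp_all add: p flip: p_def)
  have half: "(1/2) \<odot>\<^bsub>B\<^esub> (x \<oplus>\<^bsub>B\<^esub> x) = x" if "x \<in> carrier B" for x
    using that by (simp add: B.smult_r_distr B.smult_half_double)
  \<comment> \<open>Here p + q = 2 v, while p* + q* = 2 w.\<close>
  have sv: "star B v = w"
  proof -
    have sc: "star B v \<in> carrier B" "star B w \<in> carrier B" using vw by simp_all
    have "star B v \<oplus>\<^bsub>B\<^esub> star B v = (star B v \<oplus>\<^bsub>B\<^esub> star B w) \<oplus>\<^bsub>B\<^esub> (star B v \<ominus>\<^bsub>B\<^esub> star B w)"
      using sc by algebra
    also have "\<dots> = star B p \<oplus>\<^bsub>B\<^esub> star B q"
      using vw by (simp add: p q B.star_add B.star_diff)
    also have "\<dots> = w \<oplus>\<^bsub>B\<^esub> w"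
      unfolding sp sq using vw by algebra
    finally have "(1/2) \<odot>\<^bsub>B\<^esub> (star B v \<oplus>\<^bsub>B\<^esub> star B v) = (1/2) \<odot>\<^bsub>B\<^esub> (w \<oplus>\<^bsub>B\<^esub> w)"
      by (rule arg_cong)
    then show ?thesis unfolding half[OF sc(1)] half[OF vw(2)] .
  qed
  \<comment> \<open>A parallelogram law: p* p + q* q = 2 (w v + v w).\<close>
  have v_sos: "\<one>\<^bsub>B\<^esub> \<ominus>\<^bsub>B\<^esub> (star B v \<otimes>\<^bsub>B\<^esub> v \<oplus>\<^bsub>B\<^esub> v \<otimes>\<^bsub>B\<^esub> star B v) \<in> B.sos"
  proof -
    let ?r = "\<one>\<^bsub>B\<^esub> \<ominus>\<^bsub>B\<^esub> (w \<otimes>\<^bsub>B\<^esub> v \<oplus>\<^bsub>B\<^esub> v \<otimes>\<^bsub>B\<^esub> w)"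
    have "(\<one>\<^bsub>B\<^esub> \<ominus>\<^bsub>B\<^esub> star B p \<otimes>\<^bsub>B\<^esub> p) \<oplus>\<^bsub>B\<^esub> (\<one>\<^bsub>B\<^esub> \<ominus>\<^bsub>B\<^esub> star B q \<otimes>\<^bsub>B\<^esub> q) = ?r \<oplus>\<^bsub>B\<^esub> ?r"
      unfolding sp sq unfolding p q using vw by algebra
    then have "complex_of_real (1/2) \<odot>\<^bsub>B\<^esub> (?r \<oplus>\<^bsub>B\<^esub> ?r) \<in> B.sos"
      using B.sos_smult[OF B.sos_add[OF sos], of "1/2"] by simp
    then show ?thesis using half[of ?r] vw by (simp add: sv)
  qed
  \<comment> \<open>The cone generated by the sums of squares and v* v - 1; a state that is
    nonnegative on it has value at least 1 at v* v.\<close>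
  define C where "C = {k \<oplus>\<^bsub>B\<^esub> complex_of_real t \<odot>\<^bsub>B\<^esub> (star B v \<otimes>\<^bsub>B\<^esub> v \<ominus>\<^bsub>B\<^esub> \<one>\<^bsub>B\<^esub>) | k t. k \<in> B.sos \<and> t \<ge> 0}"
  let ?d = "star B v \<otimes>\<^bsub>B\<^esub> v \<ominus>\<^bsub>B\<^esub> \<one>\<^bsub>B\<^esub>"
  have C: "k \<oplus>\<^bsub>B\<^esub> complex_of_real t \<odot>\<^bsub>B\<^esub> ?d \<in> C" if "k \<in> B.sos" "t \<ge> 0" for k t
    unfolding C_def using that by blast
  have d_herm: "?d \<in> B.herm" using B.herm_square[OF vw(1)] by simp
  then have d: "?d \<in> carrier B" by simp
  have "B.pos_cone C"
    unfolding B.pos_cone_def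
  proof (intro conjI ballI allI impI subsetI)
    fix x assume "x \<in> C"
    then show "x \<in> B.herm" using d_herm B.sos_herm by (auto simp: C_def)
  next
    fix x assume "x \<in> B.sos"
    then show "x \<in> C" using C[of x 0] d by simp
  next
    fix x y assume "x \<in> C" "y \<in> C"
    then obtain k s l t where *: "k \<in> B.sos" "l \<in> B.sos" "s \<ge> 0" "t \<ge> 0"
        "x = k \<oplus>\<^bsub>B\<^esub> complex_of_real s \<odot>\<^bsub>B\<^esub> ?d" "y = l \<oplus>\<^bsub>B\<^esub> complex_of_real t \<odot>\<^bsub>B\<^esub> ?d"
      unfolding C_def by blast
    have "x \<oplus>\<^bsub>B\<^esub> y = (k \<oplus>\<^bsub>B\<^esub> l) \<oplus>\<^bsub>B\<^esub> (complex_of_real s \<odot>\<^bsub>B\<^esub> ?d \<oplus>\<^bsub>B\<^esub> complex_of_real t \<odot>\<^bsub>B\<^esub> ?d)"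
      unfolding * using *(1,2) B.smult_closed[OF d] by (simp add: B.a_ac)
    also have "\<dots> = (k \<oplus>\<^bsub>B\<^esub> l) \<oplus>\<^bsub>B\<^esub> complex_of_real (s + t) \<odot>\<^bsub>B\<^esub> ?d"
      using d by (simp only: B.smult_l_distr of_real_add)
    finally show "x \<oplus>\<^bsub>B\<^esub> y \<in> C" using C[OF B.sos_add[OF *(1,2)], of "s + t"] *(3,4) by simp
  next
    fix x and c :: real assume "x \<in> C" "c \<ge> 0"
    then obtain k s where *: "k \<in> B.sos" "s \<ge> 0" "x = k \<oplus>\<^bsub>B\<^esub> complex_of_real s \<odot>\<^bsub>B\<^esub> ?d"
      unfolding C_def by blast
    then have "complex_of_real c \<odot>\<^bsub>B\<^esub> x = complex_of_real c \<odot>\<^bsub>B\<^esub> k \<oplus>\<^bsub>B\<^esub> complex_of_real (c * s) \<odot>\<^bsub>B\<^esub> ?d"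
      using d by (simp add: B.smult_r_distr B.smult_assoc)
    then show "complex_of_real c \<odot>\<^bsub>B\<^esub> x \<in> C"
      using C[OF B.sos_smult[OF *(1) \<open>c \<ge> 0\<close>], of "c * s"] *(2) \<open>c \<ge> 0\<close> by simp
  qed
  moreover have "\<ominus>\<^bsub>B\<^esub> \<one>\<^bsub>B\<^esub> \<notin> C"
  proof
    assume "\<ominus>\<^bsub>B\<^esub> \<one>\<^bsub>B\<^esub> \<in> C"
    then obtain k t where k: "k \<in> B.sos" "t \<ge> 0" and eq: "\<ominus>\<^bsub>B\<^esub> \<one>\<^bsub>B\<^esub> = k \<oplus>\<^bsub>B\<^esub> complex_of_real t \<odot>\<^bsub>B\<^esub> ?d"
      unfolding C_def by blast
    define s where "s = complex_of_real (sqrt t)"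
    have s: "cnj s = s" "s * s = complex_of_real t" using k(2) by (simp_all add: s_def flip: of_real_mult)
    \<comment> \<open>Applying \<open>j\<close> gives the Gram matrix of the row (s v, s 1) with
      \<open>k\<close> added in the corner. By \<open>eq\<close> that corner k + t v* v is the
      scalar t - 1, so every entry can be chosen Toeplitz.\<close>
    define X :: "nat \<Rightarrow> nat \<Rightarrow> complex^2^2" where "X i l =
        (if i = 0 \<and> l = 0 then map_matrix ((*) (complex_of_real t - 1)) (mat 1)
         else if i = 0 \<and> l = 1 then map_matrix ((*) (complex_of_real t)) E21
         else if i = 1 \<and> l = 0 then map_matrix ((*) (complex_of_real t)) E12
         else if i = 1 \<and> l = 1 then map_matrix ((*) (complex_of_real t)) (mat 1) else 0)" for i l
    have XT: "X i l \<in> toeplitz2" for i l by (simp add: X_def T)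
    have corner: "(complex_of_real t - 1) \<odot>\<^bsub>B\<^esub> \<one>\<^bsub>B\<^esub> = k \<oplus>\<^bsub>B\<^esub> complex_of_real t \<odot>\<^bsub>B\<^esub> (w \<otimes>\<^bsub>B\<^esub> v)"
    proof -
      define g h where "g = complex_of_real t \<odot>\<^bsub>B\<^esub> \<one>\<^bsub>B\<^esub>" and "h = complex_of_real t \<odot>\<^bsub>B\<^esub> (w \<otimes>\<^bsub>B\<^esub> v)"
      have gh: "g \<in> carrier B" "h \<in> carrier B" "k \<in> carrier B" using vw k by (simp_all add: g_def h_def)
      have "(complex_of_real t + (- 1)) \<odot>\<^bsub>B\<^esub> \<one>\<^bsub>B\<^esub> = g \<oplus>\<^bsub>B\<^esub> (\<ominus>\<^bsub>B\<^esub> \<one>\<^bsub>B\<^esub>)"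
        by (simp only: B.smult_l_distr B.one_closed g_def B.smult_minus_one)
      also have "\<ominus>\<^bsub>B\<^esub> \<one>\<^bsub>B\<^esub> = k \<oplus>\<^bsub>B\<^esub> (h \<ominus>\<^bsub>B\<^esub> g)"
        using eq vw by (simp add: B.smult_diff_right sv g_def h_def)
      also have "g \<oplus>\<^bsub>B\<^esub> (k \<oplus>\<^bsub>B\<^esub> (h \<ominus>\<^bsub>B\<^esub> g)) = k \<oplus>\<^bsub>B\<^esub> h" using gh by algebra
      finally show ?thesis by (simp add: h_def)
    qed
    obtain n where n: "n \<ge> 2" "mat_positive B n (\<lambda>i l. j (X i l))"
    proof (rule B.mat_positive_sos_padded[of k "s \<odot>\<^bsub>B\<^esub> v" "s \<odot>\<^bsub>B\<^esub> \<one>\<^bsub>B\<^esub>" "\<lambda>i l. j (X i l)"])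
      show "j (X 0 0) = k \<oplus>\<^bsub>B\<^esub> star B (s \<odot>\<^bsub>B\<^esub> v) \<otimes>\<^bsub>B\<^esub> (s \<odot>\<^bsub>B\<^esub> v)"
        using vw corner by (simp add: X_def j_smult T j_one B.star_smult sv s B.smult_mult_left
            B.smult_mult_right flip: B.smult_assoc)
    qed (use k vw in \<open>auto simp: X_def j_smult T j_one j_zero B.star_smult sv s B.smult_mult_left
            B.smult_mult_right v_def[symmetric] w_def[symmetric] simp flip: B.smult_assoc\<close>)
    then have "mat_positive M2 n X" using j_pos[of n X] XT by simp
    \<comment> \<open>The form evaluates to (t - 1) - t - t + t = -1.\<close>
    from mat_positive_M2_quadratic_form[OF this n(1)] show False
      by (simp add: X_def)
  qed
  ultimately obtain \<phi> where \<phi>: "B.state \<phi>" "\<And>x. x \<in> C \<Longrightarrow> 0 \<le> Re (\<phi> x)"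
    using B.state_exists by metis
  have "?d \<in> C" using C[OF B.sos_zero, of 1] d by (simp add: B.smult_one)
  then have v_norm: "0 \<le> Re (\<phi> ?d)" by (rule \<phi>(2))
  note h = \<phi>(1) vw(1) v_norm v_sos
  define \<rho> where "\<rho> = B.compression \<phi> v"
  have dec: "j x = (x$1$1) \<odot>\<^bsub>B\<^esub> \<one>\<^bsub>B\<^esub> \<oplus>\<^bsub>B\<^esub> ((x$1$2) \<odot>\<^bsub>B\<^esub> v \<oplus>\<^bsub>B\<^esub> (x$2$1) \<odot>\<^bsub>B\<^esub> w)" if "x \<in> toeplitz2" for x
    by (subst toeplitz2_decomp[OF that]) (simp add: j_add j_smult T j_one v_def w_def)
  have hom: "star_hom B M2 \<rho>"
    unfolding \<rho>_def using dec sv by (intro B.star_hom_compression[OF h gen]) auto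
  have \<rho>_add: "\<And>x y. \<lbrakk>x \<in> carrier B; y \<in> carrier B\<rbrakk> \<Longrightarrow> \<rho> (x \<oplus>\<^bsub>B\<^esub> y) = \<rho> x + \<rho> y"
    and \<rho>_smult: "\<And>c x. x \<in> carrier B \<Longrightarrow> \<rho> (c \<odot>\<^bsub>B\<^esub> x) = map_matrix ((*) c) (\<rho> x)"
    and \<rho>_mult: "\<And>x y. \<lbrakk>x \<in> carrier B; y \<in> carrier B\<rbrakk> \<Longrightarrow> \<rho> (x \<otimes>\<^bsub>B\<^esub> y) = \<rho> x ** \<rho> y"
    using hom by (simp_all add: star_hom_def)
  have \<rho>: "\<rho> \<one>\<^bsub>B\<^esub> = mat 1" "\<rho> v = E12" "\<rho> w = E21"
    using B.compression_one[OF h] B.compression_v[OF h] by (simp_all add: \<rho>_def sv)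
  have "\<rho> (j x) = x" if "x \<in> toeplitz2" for x
    using toeplitz2_decomp[OF that] vw by (simp add: dec[OF that] \<rho>_add \<rho>_smult \<rho>)
  moreover have "X \<in> \<rho> ` carrier B" for X
  proof
    \<comment> \<open>The products v w and w v are preimages of the diagonal matrix units, which are
      not Toeplitz themselves.\<close>
    let ?x = "(X$1$1) \<odot>\<^bsub>B\<^esub> (v \<otimes>\<^bsub>B\<^esub> w) \<oplus>\<^bsub>B\<^esub> ((X$1$2) \<odot>\<^bsub>B\<^esub> v \<oplus>\<^bsub>B\<^esub> ((X$2$1) \<odot>\<^bsub>B\<^esub> w \<oplus>\<^bsub>B\<^esub> (X$2$2) \<odot>\<^bsub>B\<^esub> (w \<otimes>\<^bsub>B\<^esub> v)))"
    show "?x \<in> carrier B" using vw by simp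
    show "X = \<rho> ?x"
      using matrix_units_decomp[of X] vw by (simp add: \<rho>_add \<rho>_smult \<rho>_mult \<rho>)
  qed
  ultimately show ?thesis using hom by blast
qed

lemma is_cstar_envelope_toeplitz2: "is_cstar_envelope TYPE('b) M2 toeplitz2 M2 (\<lambda>x. x)"
  using operator_system_toeplitz2 generating_embedding_toeplitz2 toeplitz2_universal
  by (auto simp: is_cstar_envelope_def unital_cstar_algebra_mat_algebra)

theorem mainTheorem1:
  shows "is_cstar_envelope TYPE('b) M2 toeplitz2 M2 (\<lambda>x. x)
    \<and> induces_bij_on_pi0 signature (herm_inv_space M2 toeplitz2 M2 (\<lambda>x. x)) {-2, 0, 2}
    \<and> induces_bij_on_pi0 signature (herm_inv_space M2 (carrier M2) M2 (\<lambda>x. x)) {-2, 0, 2}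
    \<and> (is_singleton (path_components_of (inv_space M2 toeplitz2 M2 (\<lambda>x. x)))
        \<and> path_connected_space (inv_space M2 toeplitz2 M2 (\<lambda>x. x)))
    \<and> (is_singleton (path_components_of (inv_space M2 (carrier M2) M2 (\<lambda>x. x)))
        \<and> path_connected_space (inv_space M2 (carrier M2) M2 (\<lambda>x. x)))"
  by (intro conjI is_cstar_envelope_toeplitz2 signature_pi0_toeplitz2 signature_pi0_M2
      path_connected_inv_space_toeplitz2[THEN conjunct1] path_connected_inv_space_toeplitz2[THEN conjunct2]
      path_connected_inv_space_M2[THEN conjunct1] path_connected_inv_space_M2[THEN conjunct2])

end
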